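(* Let $1\le t<n$. Let $|\psi\rangle$ be an $n$-qubit pure state and let $\lambda_1\le\dots\le\lambda_n$ be the normal eigenvalues of its correlation matrix, in increasing order. Then the trace distance between $|\psi\rangle$ and the set $\mathcal{G}_t$ of pure $t$-compressible Gaussian states satisfies $$\min_{|\phi_t\rangle\in\mathcal{G}_t}d_{\mathrm{tr}}(|\psi\rangle,|\phi_t\rangle)\ \ge\ \frac12\left(1-\lambda_{t+1}\right).$$
   Context: On $n$ qubits with Pauli operators $X_k,Y_k,Z_k$, the Majorana operators are $\gamma_{2k-1}:=(\prod_{j=1}^{k-1}Z_j)X_k$ and $\gamma_{2k}:=(\prod_{j=1}^{k-1}Z_j)Y_k$, $k\in[n]:=\{1,\dots,n\}$. A Gaussian unitary is a unitary $G$ for which there is $O\in\mathrm{O}(2n)$ with $G^\dagger\gamma_\mu G=\sum_{\nu}O_{\mu,\nu}\gamma_\nu$ for all $\mu\in[2n]$. A pure state is $t$-compressible if it equals $G(|\phi\rangle\otimes|0^{n-t}\rangle)$ with $G$ a Gaussian unitary and $|\phi\rangle$ a pure state on the first $t$ qubits. $d_{\mathrm{tr}}(\rho,\sigma)=\frac12\|\rho-\sigma\|_1$. The correlation matrix of $\rho$ is the real antisymmetric matrix $[C(\rho)]_{j,k}=-\frac i2\mathrm{Tr}([\gamma_j,\gamma_k]\rho)$, $j,k\in[2n]$. The normal eigenvalues $\lambda_j\ge0$, $j\in[n]$, of a real antisymmetric $2n\times2n$ matrix $C$ are those in its normal form $C=O\bigoplus_{j=1}^n\begin{pmatrix}0&\lambda_j\\-\lambda_j&0\end{pmatrix}O^T$,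 $O\in\mathrm{O}(2n)$, ordered increasingly. *)

theory Defs
  imports Complex_Main "Jordan_Normal_Form.Schur_Decomposition"
begin

text \<open>
  Operators on \<open>n\<close> qubits are complex matrices of dimension \<open>2 ^ n\<close>. Basis vectors are indexed by
  binary strings read as numbers, the first qubit being the most significant bit. Qubits and
  Majorana operators are numbered from 1, rows and columns of matrices from 0.
\<close>

definition kron_mat :: "complex mat \<Rightarrow> complex mat \<Rightarrow> complex mat" where
  "kron_mat A B = mat (dim_row A * dim_row B) (dim_col A * dim_col B)
     (\<lambda>(i, j). A $$ (i div dim_row B, j div dim_col B) * B $$ (i mod dim_row B, j mod dim_col B))"

definition kron_vec :: "complex vec \<Rightarrow> complex vec \<Rightarrow> complex vec" where
  "kron_vec v w = vec (dim_vec v * dim_vec w) (\<lambda>i. v $ (i div dim_vec w) * w $ (i mod dim_vec w))"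

definition mat_trace :: "complex mat \<Rightarrow> complex" where
  "mat_trace A = (\<Sum>i<dim_row A. A $$ (i, i))"

definition pauli_X :: "complex mat" where
  "pauli_X = mat_of_rows_list 2 [[0, 1], [1, 0]]"

definition pauli_Y :: "complex mat" where
  "pauli_Y = mat_of_rows_list 2 [[0, - \<i>], [\<i>, 0]]"

definition pauli_Z :: "complex mat" where
  "pauli_Z = mat_of_rows_list 2 [[1, 0], [0, - 1]]"

definition on_qubit :: "nat \<Rightarrow> nat \<Rightarrow> complex mat \<Rightarrow> complex mat" where
  "on_qubit n k P = kron_mat (1\<^sub>m (2 ^ (k - 1))) (kron_mat P (1\<^sub>m (2 ^ (n - k))))"

definition jordan_wigner :: "nat \<Rightarrow> nat \<Rightarrow> complex mat \<Rightarrow> complex mat" where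
  "jordan_wigner n k P = foldr (\<lambda>j M. on_qubit n j pauli_Z * M) [1..<k] (on_qubit n k P)"

definition majorana :: "nat \<Rightarrow> nat \<Rightarrow> complex mat" where
  "majorana n \<mu> =
     (if odd \<mu> then jordan_wigner n ((\<mu> + 1) div 2) pauli_X
      else jordan_wigner n (\<mu> div 2) pauli_Y)"

definition unitary :: "nat \<Rightarrow> complex mat \<Rightarrow> bool" where
  "unitary d U \<longleftrightarrow> U \<in> carrier_mat d d \<and> mat_adjoint U * U = 1\<^sub>m d"

text \<open>
  The library predicate \<^const>\<open>orthogonal_mat\<close> only asks for pairwise orthogonal nonzero columns,
  not for orthonormal ones, so the orthogonal group is defined here.
\<close>

definition orthogonal_group :: "nat \<Rightarrow> real mat set" where
  "orthogonal_group d = {Q \<in> carrier_mat d d. transpose_mat Q * Q = 1\<^sub>m d}"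

text \<open>\<open>\<Sum>\<nu>. Q\<^sub>\<mu>\<^sub>\<nu> \<gamma>\<^sub>\<nu>\<close>, entry by entry, since matrices have no zero of unspecified dimension.\<close>

definition majorana_rotation :: "nat \<Rightarrow> real mat \<Rightarrow> nat \<Rightarrow> complex mat" where
  "majorana_rotation n Q \<mu> = mat (2 ^ n) (2 ^ n)
     (\<lambda>ij. \<Sum>\<nu>\<in>{1..2 * n}. complex_of_real (Q $$ (\<mu> - 1, \<nu> - 1)) * majorana n \<nu> $$ ij)"

definition gaussian_unitary :: "nat \<Rightarrow> complex mat \<Rightarrow> bool" where
  "gaussian_unitary n G \<longleftrightarrow> unitary (2 ^ n) G \<and>
     (\<exists>Q\<in>orthogonal_group (2 * n). \<forall>\<mu>\<in>{1..2 * n}.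
        mat_adjoint G * majorana n \<mu> * G = majorana_rotation n Q \<mu>)"

definition pure_state :: "nat \<Rightarrow> complex vec \<Rightarrow> bool" where
  "pure_state n \<psi> \<longleftrightarrow> \<psi> \<in> carrier_vec (2 ^ n) \<and> \<psi> \<bullet>c \<psi> = 1"

definition zero_state :: "nat \<Rightarrow> complex vec" where
  "zero_state m = unit_vec (2 ^ m) 0"

definition compressible_states :: "nat \<Rightarrow> nat \<Rightarrow> complex vec set" where
  "compressible_states n t =
     {G *\<^sub>v kron_vec \<phi> (zero_state (n - t)) | G \<phi>. gaussian_unitary n G \<and> pure_state t \<phi>}"

definition density :: "complex vec \<Rightarrow> complex mat" where
  "density \<psi> = mat (dim_vec \<psi>) (dim_vec \<psi>) (\<lambda>(i, j). \<psi> $ i * cnj (\<psi> $ j))"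

text \<open>
  The Schatten 1-norm is the sum of the singular values: the roots of the characteristic polynomial
  of \<open>A\<^sup>\<dagger>A\<close>, counted with multiplicity, are real and nonnegative, and the singular values
  are their square roots.
\<close>

definition trace_norm :: "complex mat \<Rightarrow> real" where
  "trace_norm A = (\<Sum>x\<in>#proots (char_poly (mat_adjoint A * A)). sqrt (Re x))"

definition trace_distance :: "complex mat \<Rightarrow> complex mat \<Rightarrow> real" where
  "trace_distance \<rho> \<sigma> = trace_norm (\<rho> - \<sigma>) / 2"

text \<open>
  \<^const>\<open>Re\<close> discards nothing for a Hermitian \<open>\<rho>\<close>: the Majorana operators are Hermitian, so their
  commutators are anti-Hermitian and the trace below is purely imaginary.
\<close>

definition correlation_matrix :: "nat \<Rightarrow> complex mat \<Rightarrow> real mat" where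
  "correlation_matrix n \<rho> = mat (2 * n) (2 * n) (\<lambda>(j, k).
     let \<gamma> = majorana n (j + 1); \<gamma>' = majorana n (k + 1)
     in Re (- \<i> / 2 * mat_trace ((\<gamma> * \<gamma>' - \<gamma>' * \<gamma>) * \<rho>)))"

text \<open>
  The values \<open>l 1, \<dots>, l n\<close> are the normal eigenvalues of \<open>C\<close> in increasing order. Every real
  antisymmetric \<open>C\<close> has such a normal form, and these values do not depend on the choice of \<open>Q\<close>.
\<close>

definition normal_eigenvalues :: "nat \<Rightarrow> real mat \<Rightarrow> (nat \<Rightarrow> real) \<Rightarrow> bool" where
  "normal_eigenvalues n C l \<longleftrightarrow>
     (\<forall>j\<in>{1..n}. 0 \<le> l j) \<and> mono_on {1..n} l \<and>
     (\<exists>Q\<in>orthogonal_group (2 * n).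
        C = Q * diag_block_mat (map (\<lambda>j. mat_of_rows_list 2 [[0, l j], [- l j, 0]]) [1..<n + 1])
              * transpose_mat Q)"

end

theory Submission
  imports Defs "HOL-Analysis.Function_Topology" "HOL-Analysis.L2_Norm"
begin

text \<open>
  For a real vector \<open>u\<close> put \<open>\<gamma>(u) = \<Sum>j. u\<^sub>j \<gamma>\<^sub>j\<close>. The anticommutation relations
  make \<open>\<gamma>(u)\<close> equal to \<open>\<parallel>u\<parallel>\<close> times an isometry, and \<open>u \<bullet> C(\<psi>) w = Im \<langle>\<gamma>(u) \<psi>, \<gamma>(w) \<psi>\<rangle>\<close>.
  If \<open>\<phi> = G (\<phi>\<^sub>0 \<otimes> 0)\<close> is compressible and \<open>G\<close> rotates by \<open>Q\<close>, then every \<open>w = Q w\<^sub>0\<close> with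
  \<open>w\<^sub>0\<close> supported on the last \<open>n - t\<close> modes has a partner \<open>u\<close> of the same length with
  \<open>\<gamma>(u) \<phi> = -\<i> \<gamma>(w) \<phi>\<close>, so the form at \<open>\<phi>\<close> has value \<open>\<parallel>w\<parallel>\<^sup>2\<close>. A dimension count provides such a
  \<open>w \<noteq> 0\<close> in the span of the first \<open>t + 1\<close> normal modes of \<open>C(\<psi>)\<close>, where the form at \<open>\<psi>\<close> is at most
  \<open>\<lambda> \<parallel>w\<parallel>\<^sup>2\<close> with \<open>\<lambda>\<close> the normal eigenvalue number \<open>t + 1\<close>. The two values differ by at most
  \<open>2 \<parallel>w\<parallel>\<^sup>2\<close> times the trace distance, which for pure states is \<open>sqrt (1 - \<bar>\<langle>\<phi>, \<psi>\<rangle>\<bar>\<^sup>2)\<close>. The minimum exists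
  because the overlap is a continuous function on a compact set of parameters.
\<close>

subsection \<open>Majorana operators\<close>

text \<open>Each index below \<open>b * q\<close> is \<open>x * q + y\<close> for exactly one
  quotient and one remainder. A sum over a Kronecker index thus becomes a double sum.\<close>

lemma sum_div_mod:
  fixes f :: "nat \<Rightarrow> nat \<Rightarrow> 'a::comm_monoid_add"
  assumes "q > 0"
  shows "(\<Sum>s<b * q. f (s div q) (s mod q)) = (\<Sum>x<b. \<Sum>y<q. f x y)"
proof -
  have "(\<Sum>s=x * q..<x * q + q. f (s div q) (s mod q)) = (\<Sum>y<q. f x y)" for x
    using assms by (subst sum.atLeastLessThan_shift_0) (auto simp: atLeast0LessThan intro!: sum.cong)
  then show ?thesis by (simp flip: sum.nat_group)
qed

lemma index_mat_mult_sum: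
  "i < dim_row A \<Longrightarrow> j < dim_col B \<Longrightarrow> dim_col A = dim_row B \<Longrightarrow>
   (A * B) $$ (i, j) = (\<Sum>k<dim_row B. A $$ (i, k) * B $$ (k, j))"
  by (simp add: scalar_prod_def atLeast0LessThan)

lemma dim_mat_adjoint [simp]:
  "dim_row (mat_adjoint A) = dim_col A" "dim_col (mat_adjoint A) = dim_row A"
  by (auto simp: mat_adjoint_def)

lemma index_mat_adjoint [simp]:
  "i < dim_col A \<Longrightarrow> j < dim_row A \<Longrightarrow> mat_adjoint A $$ (i, j) = conjugate (A $$ (j, i))"
  by (simp add: mat_adjoint_def mat_of_rows_def)

section \<open>Algebra of Kronecker products\<close>

lemma dim_kron_mat [simp]:
  "dim_row (kron_mat A B) = dim_row A * dim_row B" "dim_col (kron_mat A B) = dim_col A * dim_col B"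
  by (auto simp: kron_mat_def)

lemma index_kron_mat [simp]:
  "i < dim_row A * dim_row B \<Longrightarrow> j < dim_col A * dim_col B \<Longrightarrow>
   kron_mat A B $$ (i, j) =
     A $$ (i div dim_row B, j div dim_col B) * B $$ (i mod dim_row B, j mod dim_col B)"
  by (auto simp: kron_mat_def)

lemma mod_less_of_less_mult: "i < a * (b::nat) \<Longrightarrow> i mod b < b"
  by (cases b) auto

lemmas div_mod_bounds = less_mult_imp_div_less mod_less_of_less_mult

text \<open>The inner index splits into quotient and remainder, and the resulting double sum factors
  into the two entry sums.\<close>

lemma kron_mat_mult:
  assumes "dim_col A = dim_row C" "dim_col B = dim_row D"
  shows "kron_mat A B * kron_mat C D = kron_mat (A * C) (B * D)"
proof (rule eq_matI; (simp only: dim_kron_mat index_mult_mat(2,3))?)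
  fix i j assume i: "i < dim_row A * dim_row B" and j: "j < dim_col C * dim_col D"
  note * = div_mod_bounds[OF i] div_mod_bounds[OF j]
  have "(kron_mat A B * kron_mat C D) $$ (i, j)
      = (\<Sum>s<dim_row C * dim_row D. (\<lambda>x y.
          (A $$ (i div dim_row B, x) * B $$ (i mod dim_row B, y)) *
          (C $$ (x, j div dim_col D) * D $$ (y, j mod dim_col D))) (s div dim_row D) (s mod dim_row D))"
    using i j assms by (subst index_mat_mult_sum) (auto intro!: sum.cong)
  also have "\<dots> = (\<Sum>x<dim_row C. \<Sum>y<dim_row D.
          (A $$ (i div dim_row B, x) * B $$ (i mod dim_row B, y)) *
          (C $$ (x, j div dim_col D) * D $$ (y, j mod dim_col D)))"
  \<comment> \<open>\<open>sum_div_mod\<close> needs a positive modulus; if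
    \<open>dim_row D = 0\<close>, both sides are zero.\<close>
  proof (cases "dim_row D = 0")
    case False
    then show ?thesis by (intro sum_div_mod) simp
  qed simp
  also have "\<dots> = kron_mat (A * C) (B * D) $$ (i, j)"
    using i j assms * by (auto simp: index_mat_mult_sum sum_product mult_ac simp del: index_mult_mat(1)
      intro!: sum.cong)
  finally show "(kron_mat A B * kron_mat C D) $$ (i, j) = kron_mat (A * C) (B * D) $$ (i, j)" .
qed

lemma kron_mat_adjoint: "mat_adjoint (kron_mat A B) = kron_mat (mat_adjoint A) (mat_adjoint B)"
  by (rule eq_matI) (auto simp: div_mod_bounds)

lemma kron_mat_one: "kron_mat (1\<^sub>m a) (1\<^sub>m b) = 1\<^sub>m (a * b)"
proof (rule eq_matI)
  fix i j assume "i < dim_row (1\<^sub>m (a * b) :: complex mat)" "j < dim_col (1\<^sub>m (a * b) :: complex mat)"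
  then have ij: "i < a * b" "j < a * b" by auto
  have "i div b = j div b \<Longrightarrow> i mod b = j mod b \<Longrightarrow> i = j" by (metis div_mult_mod_eq)
  then show "kron_mat (1\<^sub>m a) (1\<^sub>m b) $$ (i, j) = 1\<^sub>m (a * b) $$ (i, j)"
    using ij div_mod_bounds[OF ij(1)] div_mod_bounds[OF ij(2)] by auto
qed auto

text \<open>The digit identities behind associativity of \<open>kron_mat\<close>: an index has three
  mixed-radix digits, which can be grouped from either side.\<close>

lemma div_mod_mult:
  fixes i q r :: nat
  assumes "r > 0"
  shows "i div (q * r) = i div r div q" "i mod (q * r) div r = i div r mod q" "i mod (q * r) mod r = i mod r"
  using assms by (simp_all add: mult.commute[of q r] div_mult2_eq mod_mult2_eq)

lemma kron_mat_assoc: "kron_mat (kron_mat A B) C = kron_mat A (kron_mat B C)"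
proof (rule eq_matI; (simp only: dim_kron_mat mult.assoc)?)
  fix i j assume i: "i < dim_row A * (dim_row B * dim_row C)" and j: "j < dim_col A * (dim_col B * dim_col C)"
  have *: "i div dim_row C < dim_row A * dim_row B" "j div dim_col C < dim_col A * dim_col B"
    using i j by (auto intro!: less_mult_imp_div_less simp: mult_ac)
  have **: "i mod (dim_row B * dim_row C) < dim_row B * dim_row C"
      "j mod (dim_col B * dim_col C) < dim_col B * dim_col C"
    using i j by (auto intro: mod_less_of_less_mult)
  have "dim_row C > 0" "dim_col C > 0" using i j by (auto intro!: Nat.gr0I)
  then show "kron_mat (kron_mat A B) C $$ (i, j) = kron_mat A (kron_mat B C) $$ (i, j)"
    using i j * ** by (simp add: div_mod_mult mult.assoc)
qed

lemma kron_mat_add_right: "dim_row B = dim_row C \<Longrightarrow> dim_col B = dim_col C \<Longrightarrow>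
   kron_mat A (B + C) = kron_mat A B + kron_mat A C"
  by (rule eq_matI) (auto simp: div_mod_bounds algebra_simps)

lemma kron_mat_add_left: "dim_row B = dim_row C \<Longrightarrow> dim_col B = dim_col C \<Longrightarrow>
   kron_mat (B + C) A = kron_mat B A + kron_mat C A"
  by (rule eq_matI) (auto simp: div_mod_bounds algebra_simps)

lemma kron_mat_zero:
  "kron_mat (0\<^sub>m a b) A = 0\<^sub>m (a * dim_row A) (b * dim_col A)"
  "kron_mat A (0\<^sub>m a b) = 0\<^sub>m (dim_row A * a) (dim_col A * b)"
  by (rule eq_matI; auto simp: div_mod_bounds)+

section \<open>Relations between the Pauli matrices\<close>

lemma pauli_carrier [simp]:
  "pauli_X \<in> carrier_mat 2 2" "pauli_Y \<in> carrier_mat 2 2" "pauli_Z \<in> carrier_mat 2 2"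
  by (auto simp: pauli_X_def pauli_Y_def pauli_Z_def mat_of_rows_list_def)

lemma pauli_dim [simp]:
  "dim_row pauli_X = 2" "dim_col pauli_X = 2" "dim_row pauli_Y = 2" "dim_col pauli_Y = 2"
  "dim_row pauli_Z = 2" "dim_col pauli_Z = 2"
  by (auto simp: pauli_X_def pauli_Y_def pauli_Z_def mat_of_rows_list_def)

lemma nat_less_2_iff: "i < 2 \<longleftrightarrow> i = 0 \<or> i = (1::nat)" by auto

lemma pauli_adjoint:
  "mat_adjoint pauli_X = pauli_X" "mat_adjoint pauli_Y = pauli_Y" "mat_adjoint pauli_Z = pauli_Z"
  by (rule eq_matI; auto simp: nat_less_2_iff; simp add: pauli_X_def pauli_Y_def pauli_Z_def mat_of_rows_list_def)+

lemma pauli_square: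
  "pauli_X * pauli_X = 1\<^sub>m 2" "pauli_Y * pauli_Y = 1\<^sub>m 2" "pauli_Z * pauli_Z = 1\<^sub>m 2"
  by (rule eq_matI; auto simp: nat_less_2_iff; simp add: pauli_X_def pauli_Y_def pauli_Z_def mat_of_rows_list_def scalar_prod_def)+

text \<open>Both orders of each pair are listed so that they serve as rewrite rules without
  commuting a matrix sum.\<close>

lemma pauli_anticommute:
  "pauli_Y * pauli_X + pauli_X * pauli_Y = 0\<^sub>m 2 2"
  "pauli_Z * pauli_X + pauli_X * pauli_Z = 0\<^sub>m 2 2"
  "pauli_Z * pauli_Y + pauli_Y * pauli_Z = 0\<^sub>m 2 2"
  "pauli_X * pauli_Y + pauli_Y * pauli_X = 0\<^sub>m 2 2"
  "pauli_X * pauli_Z + pauli_Z * pauli_X = 0\<^sub>m 2 2"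
  "pauli_Y * pauli_Z + pauli_Z * pauli_Y = 0\<^sub>m 2 2"
  by (rule eq_matI; auto simp: nat_less_2_iff; simp add: pauli_X_def pauli_Y_def pauli_Z_def mat_of_rows_list_def scalar_prod_def)+

section \<open>Single-qubit operators and Jordan-Wigner strings\<close>

lemma on_qubit_carrier:
  assumes "1 \<le> k" "k \<le> n" "P \<in> carrier_mat 2 2"
  shows "on_qubit n k P \<in> carrier_mat (2 ^ n) (2 ^ n)"
proof -
  have "k - 1 + Suc (n - k) = n" using assms by simp
  then have "(2::nat) ^ n = 2 ^ (k - 1) * (2 * 2 ^ (n - k))" by (metis power_add power_Suc)
  then show ?thesis using assms(3) by (auto simp: on_qubit_def)
qed

lemma on_qubit_first: "P \<in> carrier_mat 2 2 \<Longrightarrow> on_qubit (Suc n) 1 P = kron_mat P (1\<^sub>m (2 ^ n))"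
  by (rule eq_matI) (auto simp: on_qubit_def)

lemma on_qubit_Suc:
  assumes "1 \<le> k"
  shows "on_qubit (Suc n) (Suc k) P = kron_mat (1\<^sub>m 2) (on_qubit n k P)"
proof -
  have "(2::nat) ^ k = 2 * 2 ^ (k - 1)" using assms by (cases k) auto
  then show ?thesis by (simp add: on_qubit_def flip: kron_mat_one kron_mat_assoc)
qed

lemma jordan_wigner_first: "P \<in> carrier_mat 2 2 \<Longrightarrow> jordan_wigner (Suc n) 1 P = kron_mat P (1\<^sub>m (2 ^ n))"
  using on_qubit_first by (simp add: jordan_wigner_def)


lemma jordan_wigner_carrier:
  assumes "1 \<le> k" "k \<le> n" "P \<in> carrier_mat 2 2"
  shows "jordan_wigner n k P \<in> carrier_mat (2 ^ n) (2 ^ n)"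
proof -
  have *: "foldr (\<lambda>j. (*) (on_qubit n j pauli_Z)) js M \<in> carrier_mat (2 ^ n) (2 ^ n)"
    if "\<forall>j\<in>set js. 1 \<le> j \<and> j \<le> n" "M \<in> carrier_mat (2 ^ n) (2 ^ n)" for js M
    using that by (induction js) (auto intro!: mult_carrier_mat on_qubit_carrier)
  show ?thesis unfolding jordan_wigner_def using assms by (intro *) (auto intro!: on_qubit_carrier)
qed

text \<open>Splitting off the first qubit: the first \<open>pauli_Z\<close> of the string becomes
  the left factor, and everything else acts there as the identity. This recursion opens the way to
  induction on \<open>n\<close>.\<close>

lemma jordan_wigner_Suc:
  assumes k: "1 \<le> k" "k \<le> n" and P: "P \<in> carrier_mat 2 2"
  shows "jordan_wigner (Suc n) (Suc k) P = kron_mat pauli_Z (jordan_wigner n k P)"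
proof -
  \<comment> \<open>The row dimension is carried along because \<open>kron_mat_mult\<close> needs
    matching inner dimensions.\<close>
  have *: "foldr (\<lambda>j. (*) (on_qubit (Suc n) j pauli_Z)) (map Suc js) (kron_mat (1\<^sub>m 2) M)
      = kron_mat (1\<^sub>m 2) (foldr (\<lambda>j. (*) (on_qubit n j pauli_Z)) js M)
      \<and> dim_row (foldr (\<lambda>j. (*) (on_qubit n j pauli_Z)) js M) = 2 ^ n"
    if "\<forall>j\<in>set js. 1 \<le> j \<and> j \<le> n" "dim_row M = 2 ^ n" for js M
    using that(1)
  proof (induction js)
    case (Cons j js)
    then have "on_qubit n j pauli_Z \<in> carrier_mat (2 ^ n) (2 ^ n)" by (auto intro!: on_qubit_carrier)
    with Cons show ?case
      by (auto simp: on_qubit_Suc kron_mat_mult)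
  qed (use that in simp)
  have "[1..<Suc k] = 1 # map Suc [1..<k]" using k by (simp add: upt_conv_Cons map_Suc_upt)
  then have "jordan_wigner (Suc n) (Suc k) P
     = on_qubit (Suc n) 1 pauli_Z * foldr (\<lambda>j. (*) (on_qubit (Suc n) j pauli_Z)) (map Suc [1..<k]) (on_qubit (Suc n) (Suc k) P)"
    by (simp add: jordan_wigner_def)
  also have "\<dots> = kron_mat pauli_Z (1\<^sub>m (2 ^ n)) * kron_mat (1\<^sub>m 2) (jordan_wigner n k P)"
    using k P *[of "[1..<k]" "on_qubit n k P"] on_qubit_carrier[OF k P]
    by (simp add: on_qubit_first[simplified] on_qubit_Suc jordan_wigner_def)
  also have "\<dots> = kron_mat pauli_Z (jordan_wigner n k P)"
    using jordan_wigner_carrier[OF k P] by (simp add: kron_mat_mult right_mult_one_mat[OF pauli_carrier(3)])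
  finally show ?thesis .
qed

lemma majorana_first:
  "majorana (Suc n) 1 = kron_mat pauli_X (1\<^sub>m (2 ^ n))"
  "majorana (Suc n) 2 = kron_mat pauli_Y (1\<^sub>m (2 ^ n))"
  by (simp_all add: majorana_def jordan_wigner_first[simplified])

text \<open>A new first qubit shifts \<open>\<mu>\<close> by two, so its parity, and with it the
  choice between \<open>pauli_X\<close> and \<open>pauli_Y\<close>, is unchanged.\<close>

lemma majorana_Suc_Suc:
  assumes "\<mu> \<in> {1..2 * n}"
  shows "majorana (Suc n) (Suc (Suc \<mu>)) = kron_mat pauli_Z (majorana n \<mu>)"
proof -
  show ?thesis
  proof (cases "even \<mu>")
    case True
    then obtain k where k: "\<mu> = 2 * k" by (elim evenE)
    with assms have "1 \<le> k" "k \<le> n" by auto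
    with jordan_wigner_Suc[OF this, of pauli_Y] show ?thesis
      by (simp add: majorana_def k)
  next
    case False
    then obtain m where m: "\<mu> = 2 * m + 1" by (elim oddE)
    with assms have "1 \<le> Suc m" "Suc m \<le> n" by auto
    with jordan_wigner_Suc[OF this, of pauli_X] show ?thesis
      by (simp add: majorana_def m)
  qed
qed

section \<open>Hermiticity and anticommutation relations\<close>

lemma majorana_carrier: "\<mu> \<in> {1..2 * n} \<Longrightarrow> majorana n \<mu> \<in> carrier_mat (2 ^ n) (2 ^ n)"
  unfolding majorana_def by (auto intro!: jordan_wigner_carrier elim!: evenE oddE)

lemma majorana_cases:
  assumes "\<mu> \<in> {1..2 * Suc n}"
  obtains "\<mu> = 1" | "\<mu> = 2" | \<nu> where "\<nu> \<in> {1..2 * n}" "\<mu> = Suc (Suc \<nu>)"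
proof -
  have "\<mu> = 1 \<or> \<mu> = 2 \<or> (\<mu> - 2 \<in> {1..2 * n} \<and> \<mu> = Suc (Suc (\<mu> - 2)))" using assms by auto
  then show ?thesis using that by blast
qed

lemma mat_adjoint_one: "mat_adjoint (1\<^sub>m k :: complex mat) = 1\<^sub>m k"
  by (rule eq_matI) auto

lemma majorana_adjoint: "\<mu> \<in> {1..2 * n} \<Longrightarrow> mat_adjoint (majorana n \<mu>) = majorana n \<mu>"
proof (induction n arbitrary: \<mu>)
  case (Suc n)
  from Suc.prems show ?case
    by (cases rule: majorana_cases)
      (use Suc.IH in \<open>auto simp: majorana_first[simplified] majorana_Suc_Suc kron_mat_adjoint pauli_adjoint mat_adjoint_one\<close>)
qed simp

lemma majorana_square: "\<mu> \<in> {1..2 * n} \<Longrightarrow> majorana n \<mu> * majorana n \<mu> = 1\<^sub>m (2 ^ n)"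
proof (induction n arbitrary: \<mu>)
  case (Suc n)
  from Suc.prems show ?case
    by (cases rule: majorana_cases)
      (use Suc.IH in \<open>auto simp: majorana_first[simplified] majorana_Suc_Suc kron_mat_mult pauli_square kron_mat_one carrier_matD[OF majorana_carrier]\<close>)
qed simp

text \<open>If one operator belongs to the first qubit, the Pauli matrices in the left factor
  anticommute. Otherwise the left factor is the square of \<open>pauli_Z\<close> and the induction
  hypothesis applies to the right factor.\<close>

lemma majorana_anticommute:
  "\<mu> \<in> {1..2 * n} \<Longrightarrow> \<nu> \<in> {1..2 * n} \<Longrightarrow> \<mu> \<noteq> \<nu> \<Longrightarrow>
   majorana n \<mu> * majorana n \<nu> + majorana n \<nu> * majorana n \<mu> = 0\<^sub>m (2 ^ n) (2 ^ n)"
proof (induction n arbitrary: \<mu> \<nu>)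
  case (Suc n)
  note D = carrier_matD[OF majorana_carrier[of _ n]]
  show ?case
    using Suc.prems(1)
  proof (cases rule: majorana_cases)
    case 1
    show ?thesis using Suc.prems(2)
      by (cases rule: majorana_cases) (use Suc.prems 1 in \<open>auto simp: majorana_first[simplified] majorana_Suc_Suc kron_mat_mult D right_mult_one_mat[OF majorana_carrier] left_mult_one_mat[OF majorana_carrier] pauli_anticommute kron_mat_zero simp flip: kron_mat_add_left\<close>)
  next
    case 2
    show ?thesis using Suc.prems(2)
      by (cases rule: majorana_cases) (use Suc.prems 2 in \<open>auto simp: majorana_first[simplified] majorana_Suc_Suc kron_mat_mult D right_mult_one_mat[OF majorana_carrier] left_mult_one_mat[OF majorana_carrier] pauli_anticommute kron_mat_zero simp flip: kron_mat_add_left\<close>)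
  next
    case (3 \<mu>')
    show ?thesis using Suc.prems(2)
      by (cases rule: majorana_cases) (use Suc 3 in \<open>auto simp: majorana_first[simplified] majorana_Suc_Suc kron_mat_mult D right_mult_one_mat[OF majorana_carrier] left_mult_one_mat[OF majorana_carrier] pauli_anticommute kron_mat_zero pauli_square simp flip: kron_mat_add_left kron_mat_add_right\<close>)
  qed
qed simp

subsection \<open>Real linear combinations of Majorana operators\<close>

lemma kron_vec_carrier: "v \<in> carrier_vec a \<Longrightarrow> w \<in> carrier_vec b \<Longrightarrow> kron_vec v w \<in> carrier_vec (a * b)"
  by (auto simp: kron_vec_def)

lemma zero_state_carrier: "zero_state m \<in> carrier_vec (2 ^ m)"
  by (simp add: zero_state_def)

text \<open>The first columns show that \<open>pauli_Y\<close> and \<open>\<i>\<close> times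
  \<open>pauli_X\<close> agree on the state 0.\<close>

lemma pauli_index:
  "pauli_X $$ (0, 0) = 0" "pauli_X $$ (Suc 0, 0) = 1" "pauli_Y $$ (0, 0) = 0" "pauli_Y $$ (Suc 0, 0) = \<i>"
  by (simp_all add: pauli_X_def pauli_Y_def mat_of_rows_list_def)

text \<open>An index splits into \<open>k - 1\<close> leading bits, bit \<open>k\<close> and
  \<open>n - k\<close> trailing bits. The identity factors force the outer bits of row and column to
  agree.\<close>

lemma index_on_qubit:
  assumes "1 \<le> k" "k \<le> n" "P \<in> carrier_mat 2 2" "i < 2 ^ n" "j < 2 ^ n"
  shows "on_qubit n k P $$ (i, j) =
    (if i div (2 * 2 ^ (n - k)) = j div (2 * 2 ^ (n - k)) \<and> i mod 2 ^ (n - k) = j mod 2 ^ (n - k)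
     then P $$ (i mod (2 * 2 ^ (n - k)) div 2 ^ (n - k), j mod (2 * 2 ^ (n - k)) div 2 ^ (n - k)) else 0)"
proof -
  define q :: nat where "q = 2 ^ (n - k)"
  have "k - 1 + Suc (n - k) = n" using assms(1,2) by simp
  then have N: "(2::nat) ^ n = 2 ^ (k - 1) * (2 * q)" unfolding q_def by (metis power_add power_Suc)
  have q: "q > 0" by (simp add: q_def)
  have b: "i div (2 * q) < 2 ^ (k - 1)" "j div (2 * q) < 2 ^ (k - 1)"
    using assms(4,5) unfolding N by (auto intro: less_mult_imp_div_less)
  show ?thesis
    using assms q b unfolding on_qubit_def q_def[symmetric]
    by (auto simp: N div_mod_mult)
qed

text \<open>Qubit \<open>k\<close> lies beyond the first \<open>t\<close> and is therefore in state
  0, so only first columns of the Pauli matrices are met.\<close>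

lemma on_qubit_zero_state:
  assumes t: "t < k" "k \<le> n" and \<phi>: "\<phi> \<in> carrier_vec (2 ^ t)"
  defines "\<chi> \<equiv> kron_vec \<phi> (zero_state (n - t))"
  shows "on_qubit n k pauli_Y *\<^sub>v \<chi> = \<i> \<cdot>\<^sub>v (on_qubit n k pauli_X *\<^sub>v \<chi>)"
proof -
  have "(2::nat) ^ t * 2 ^ (n - t) = 2 ^ n" using t by (simp flip: power_add)
  then have \<chi>: "\<chi> \<in> carrier_vec (2 ^ n)"
    using kron_vec_carrier[OF \<phi> zero_state_carrier, of "n - t"] by (simp add: \<chi>_def)
  have k: "1 \<le> k" "k \<le> n" using t by auto
  note c = on_qubit_carrier[OF k pauli_carrier(1)] on_qubit_carrier[OF k pauli_carrier(2)]
  \<comment> \<open>A nonzero amplitude has \<open>n - t\<close> trailing zero bits; since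
    \<open>t < k\<close>, bit \<open>k\<close> and all bits after it are among them.\<close>
  have zero: "j mod (2 * 2 ^ (n - k)) = 0" if j: "j < 2 ^ n" "\<chi> $ j \<noteq> 0" for j
  proof -
    have "j mod 2 ^ (n - t) = 0"
      using j \<chi> by (auto simp: \<chi>_def kron_vec_def zero_state_def split: if_splits)
    moreover have "(2 ^ Suc (n - k) :: nat) dvd 2 ^ (n - t)"
      using t by (intro le_imp_power_dvd) simp
    ultimately show ?thesis by (metis dvd_trans mod_eq_0_iff_dvd power_Suc)
  qed
  have eq: "on_qubit n k pauli_Y $$ (i, j) * \<chi> $ j = \<i> * (on_qubit n k pauli_X $$ (i, j) * \<chi> $ j)"
    if ij: "i < 2 ^ n" "j < 2 ^ n" for i j
  proof (cases "\<chi> $ j = 0")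
    case False
    have "i mod (2 * 2 ^ (n - k)) div 2 ^ (n - k) < 2"
      by (rule less_mult_imp_div_less) simp
    then have "i mod (2 * 2 ^ (n - k)) div 2 ^ (n - k) \<in> {0, 1}" by auto
    then show ?thesis
      using zero[OF ij(2) False]
      by (auto simp: index_on_qubit[OF k _ ij] pauli_index)
  qed simp
  show ?thesis
    using c \<chi> eq by (intro eq_vecI) (auto simp: scalar_prod_def sum_distrib_left intro!: sum.cong)
qed

text \<open>The relation on qubit \<open>k\<close> survives multiplication from the left by the
  \<open>pauli_Z\<close> factors of the string, one factor at a time.\<close>

lemma jordan_wigner_zero_state:
  assumes t: "t < k" "k \<le> n" and \<phi>: "\<phi> \<in> carrier_vec (2 ^ t)"
  defines "\<chi> \<equiv> kron_vec \<phi> (zero_state (n - t))"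
  shows "jordan_wigner n k pauli_Y *\<^sub>v \<chi> = \<i> \<cdot>\<^sub>v (jordan_wigner n k pauli_X *\<^sub>v \<chi>)"
proof -
  have "(2::nat) ^ t * 2 ^ (n - t) = 2 ^ n" using t by (simp flip: power_add)
  then have \<chi>: "\<chi> \<in> carrier_vec (2 ^ n)"
    using kron_vec_carrier[OF \<phi> zero_state_carrier, of "n - t"] by (simp add: \<chi>_def)
  have k: "1 \<le> k" "k \<le> n" using t by auto
  let ?F = "foldr (\<lambda>j. (*) (on_qubit n j pauli_Z))"
  have "?F js M \<in> carrier_mat (2 ^ n) (2 ^ n) \<and> ?F js M' \<in> carrier_mat (2 ^ n) (2 ^ n) \<and>
      ?F js M *\<^sub>v \<chi> = \<i> \<cdot>\<^sub>v (?F js M' *\<^sub>v \<chi>)"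
    if "\<forall>j\<in>set js. 1 \<le> j \<and> j \<le> n" "M \<in> carrier_mat (2 ^ n) (2 ^ n)" "M' \<in> carrier_mat (2 ^ n) (2 ^ n)"
      "M *\<^sub>v \<chi> = \<i> \<cdot>\<^sub>v (M' *\<^sub>v \<chi>)" for js M M'
    using that(1)
  proof (induction js)
    case (Cons j js)
    then have A: "on_qubit n j pauli_Z \<in> carrier_mat (2 ^ n) (2 ^ n)" by (auto intro!: on_qubit_carrier)
    have IH: "?F js M \<in> carrier_mat (2 ^ n) (2 ^ n)" "?F js M' \<in> carrier_mat (2 ^ n) (2 ^ n)"
      "?F js M *\<^sub>v \<chi> = \<i> \<cdot>\<^sub>v (?F js M' *\<^sub>v \<chi>)" using Cons by auto
    then show ?case using A \<chi>
      by (simp add: mult_mat_vec[OF A] assoc_mult_mat_vec[OF A])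
  qed (use that in simp)
  from this[OF _ on_qubit_carrier[OF k pauli_carrier(2)] on_qubit_carrier[OF k pauli_carrier(1)]
      on_qubit_zero_state[OF t \<phi>, folded \<chi>_def], of "[1..<k]"]
  show ?thesis unfolding jordan_wigner_def using k by auto
qed

text \<open>Modes count from 0 here: mode \<open>k\<close> is qubit \<open>k + 1\<close>, and
  \<open>t \<le> k\<close> places it among the qubits in state 0.\<close>

lemma majorana_zero_state:
  assumes "t \<le> k" "k < n" "\<phi> \<in> carrier_vec (2 ^ t)"
  shows "majorana n (2 * k + 2) *\<^sub>v kron_vec \<phi> (zero_state (n - t))
    = \<i> \<cdot>\<^sub>v (majorana n (2 * k + 1) *\<^sub>v kron_vec \<phi> (zero_state (n - t)))"
  using jordan_wigner_zero_state[of t "Suc k" n \<phi>] assms by (simp add: majorana_def)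

section \<open>Complex inner product and norm\<close>

lemma cscalar_prod_sum: "dim_vec v = dim_vec w \<Longrightarrow> v \<bullet>c w = (\<Sum>i<dim_vec w. v $ i * cnj (w $ i))"
  by (simp add: scalar_prod_def atLeast0LessThan)

lemma cscalar_prod_adjoint:
  fixes A :: "complex mat"
  assumes "A \<in> carrier_mat m k" "v \<in> carrier_vec k" "w \<in> carrier_vec m"
  shows "(A *\<^sub>v v) \<bullet>c w = v \<bullet>c (mat_adjoint A *\<^sub>v w)"
proof -
  have "(A *\<^sub>v v) \<bullet>c w = (\<Sum>i<m. \<Sum>j<k. A $$ (i, j) * v $ j * cnj (w $ i))"
    using assms by (simp add: cscalar_prod_sum) (simp add: scalar_prod_def atLeast0LessThan sum_distrib_right)
  also have "\<dots> = (\<Sum>j<k. \<Sum>i<m. A $$ (i, j) * v $ j * cnj (w $ i))" by (rule sum.swap)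
  also have "\<dots> = v \<bullet>c (mat_adjoint A *\<^sub>v w)"
    using assms by (simp add: cscalar_prod_sum) (simp add: scalar_prod_def atLeast0LessThan sum_distrib_left mult_ac)
  finally show ?thesis .
qed

lemma cscalar_prod_swap:
  fixes v w :: "complex vec"
  shows "dim_vec v = dim_vec w \<Longrightarrow> w \<bullet>c v = cnj (v \<bullet>c w)"
  by (simp add: cscalar_prod_sum mult.commute)

text \<open>Encoded through \<open>L2_set\<close> so that Cauchy-Schwarz comes from
  \<open>L2_set_mult_ineq\<close>.\<close>

definition vec_norm :: "complex vec \<Rightarrow> real" where
  "vec_norm v = L2_set (\<lambda>i. cmod (v $ i)) {..<dim_vec v}"

lemma vec_norm_nonneg: "vec_norm v \<ge> 0"
  by (simp add: vec_norm_def)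

lemma cscalar_prod_self: "v \<bullet>c v = complex_of_real ((vec_norm v)\<^sup>2)"
  by (simp add: cscalar_prod_sum vec_norm_def L2_set_def sum_nonneg flip: complex_norm_square)

lemma cscalar_prod_le:
  assumes "dim_vec v = dim_vec w"
  shows "cmod (v \<bullet>c w) \<le> vec_norm v * vec_norm w"
proof -
  have "cmod (v \<bullet>c w) \<le> (\<Sum>i<dim_vec w. \<bar>cmod (v $ i)\<bar> * \<bar>cmod (w $ i)\<bar>)"
    unfolding cscalar_prod_sum[OF assms] by (rule order.trans[OF norm_sum]) (simp add: norm_mult)
  also have "\<dots> \<le> vec_norm v * vec_norm w"
    unfolding vec_norm_def using L2_set_mult_ineq[of "\<lambda>i. cmod (v $ i)" "\<lambda>i. cmod (w $ i)"] assms by auto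
  finally show ?thesis .
qed

text \<open>This is \<open>\<gamma>(u)\<close> applied to \<open>v\<close>. The operator occurs only
  in this way, so no matrix sum is formed; coordinate \<open>j\<close> of \<open>u\<close> belongs
  to Majorana operator \<open>Suc j\<close>.\<close>

definition field_op :: "nat \<Rightarrow> real vec \<Rightarrow> complex vec \<Rightarrow> complex vec" where
  "field_op n u v = vec (2 ^ n)
     (\<lambda>i. \<Sum>j<2 * n. complex_of_real (u $ j) * (majorana n (Suc j) *\<^sub>v v) $ i)"

lemma field_op_carrier [simp]: "field_op n u v \<in> carrier_vec (2 ^ n)" "dim_vec (field_op n u v) = 2 ^ n"
  by (simp_all add: field_op_def)

lemma majorana_vec_carrier [simp]: "j < 2 * n \<Longrightarrow> majorana n (Suc j) *\<^sub>v v \<in> carrier_vec (2 ^ n)"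
   "j < 2 * n \<Longrightarrow> dim_row (majorana n (Suc j)) = 2 ^ n"
  using majorana_carrier[of "Suc j" n] by (auto intro!: carrier_vecI)

lemma field_op_inner:
  "field_op n u v \<bullet>c field_op n w v' = (\<Sum>j<2 * n. \<Sum>k<2 * n.
     complex_of_real (u $ j * w $ k) * ((majorana n (Suc j) *\<^sub>v v) \<bullet>c (majorana n (Suc k) *\<^sub>v v')))"
proof -
  have "field_op n u v \<bullet>c field_op n w v' = (\<Sum>i<2 ^ n. \<Sum>j<2 * n. \<Sum>k<2 * n.
     complex_of_real (u $ j * w $ k) * ((majorana n (Suc j) *\<^sub>v v) $ i * cnj ((majorana n (Suc k) *\<^sub>v v') $ i)))"
    by (simp add: cscalar_prod_sum) (simp add: field_op_def sum_product mult_ac)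
  also have "\<dots> = (\<Sum>j<2 * n. \<Sum>k<2 * n. \<Sum>i<2 ^ n.
     complex_of_real (u $ j * w $ k) * ((majorana n (Suc j) *\<^sub>v v) $ i * cnj ((majorana n (Suc k) *\<^sub>v v') $ i)))"
    by (rule trans[OF sum.swap]) (rule sum.cong[OF refl], rule sum.swap)
  also have "\<dots> = (\<Sum>j<2 * n. \<Sum>k<2 * n.
     complex_of_real (u $ j * w $ k) * ((majorana n (Suc j) *\<^sub>v v) \<bullet>c (majorana n (Suc k) *\<^sub>v v')))"
    by (intro sum.cong refl) (auto simp: cscalar_prod_sum sum_distrib_left)
  finally show ?thesis .
qed

text \<open>Moving one Hermitian operator across each inner product leaves the expectation of the
  anticommutator.\<close>

lemma majorana_inner_symmetrized:
  assumes "j < 2 * n" "k < 2 * n" and v: "v \<in> carrier_vec (2 ^ n)"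
  shows "(majorana n (Suc j) *\<^sub>v v) \<bullet>c (majorana n (Suc k) *\<^sub>v v)
    + (majorana n (Suc k) *\<^sub>v v) \<bullet>c (majorana n (Suc j) *\<^sub>v v) = (if j = k then 2 * (v \<bullet>c v) else 0)"
proof -
  define A B where "A = majorana n (Suc j)" and "B = majorana n (Suc k)"
  have \<mu>: "Suc j \<in> {1..2 * n}" "Suc k \<in> {1..2 * n}" using assms by auto
  have A: "A \<in> carrier_mat (2 ^ n) (2 ^ n)" and B: "B \<in> carrier_mat (2 ^ n) (2 ^ n)"
    unfolding A_def B_def using \<mu> majorana_carrier by blast+
  have "(A *\<^sub>v v) \<bullet>c (B *\<^sub>v v) = v \<bullet>c ((A * B) *\<^sub>v v)" "(B *\<^sub>v v) \<bullet>c (A *\<^sub>v v) = v \<bullet>c ((B * A) *\<^sub>v v)"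
    using A B v majorana_adjoint[OF \<mu>(1)] majorana_adjoint[OF \<mu>(2)]
      cscalar_prod_adjoint[OF A v, of "B *\<^sub>v v"] cscalar_prod_adjoint[OF B v, of "A *\<^sub>v v"]
    by (simp_all add: A_def[symmetric] B_def[symmetric])
  moreover have "v \<bullet>c ((A * B) *\<^sub>v v) + v \<bullet>c ((B * A) *\<^sub>v v) = v \<bullet>c ((A * B + B * A) *\<^sub>v v)"
    using A B v by (simp add: add_mult_distrib_mat_vec[where nr = "2 ^ n" and nc = "2 ^ n"] cscalar_prod_sum)
      (simp add: algebra_simps sum.distrib)
  moreover have "v \<bullet>c ((A * B + B * A) *\<^sub>v v) = (if j = k then 2 * (v \<bullet>c v) else 0)"
  proof (cases "j = k")
    case True
    then have "A * B + B * A = 1\<^sub>m (2 ^ n) + 1\<^sub>m (2 ^ n)"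
      using majorana_square[OF \<mu>(1)] by (simp add: A_def B_def)
    moreover have "(1\<^sub>m (2 ^ n) + 1\<^sub>m (2 ^ n)) *\<^sub>v v = v + v"
      using v by (simp add: add_mult_distrib_mat_vec[where nr = "2 ^ n" and nc = "2 ^ n"])
    ultimately show ?thesis using True v by (simp add: cscalar_prod_sum algebra_simps sum_distrib_left)
  next
    case False
    then show ?thesis using majorana_anticommute[OF \<mu>] v by (simp add: A_def B_def cscalar_prod_sum scalar_prod_def)
  qed
  ultimately show ?thesis by (simp add: A_def B_def)
qed

text \<open>The squared norm is a double sum. Adding to it the same sum with \<open>j\<close> and
  \<open>k\<close> exchanged produces anticommutators, of which only the diagonal survives.\<close>

lemma vec_norm_field_op:
  assumes u: "u \<in> carrier_vec (2 * n)" and v: "v \<in> carrier_vec (2 ^ n)"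
  shows "vec_norm (field_op n u v) = sqrt (u \<bullet> u) * vec_norm v"
proof -
  define h where "h j k = (majorana n (Suc j) *\<^sub>v v) \<bullet>c (majorana n (Suc k) *\<^sub>v v)" for j k
  define S where "S = field_op n u v \<bullet>c field_op n u v"
  have S: "S = (\<Sum>j<2 * n. \<Sum>k<2 * n. complex_of_real (u $ j * u $ k) * h j k)"
    unfolding S_def by (simp add: field_op_inner h_def)
  have S': "S = (\<Sum>j<2 * n. \<Sum>k<2 * n. complex_of_real (u $ j * u $ k) * h k j)"
    unfolding S by (subst sum.swap) (simp add: mult_ac)
  have "S + S = (\<Sum>j<2 * n. \<Sum>k<2 * n. complex_of_real (u $ j * u $ k) * (h j k + h k j))"
    by (subst S, subst S') (simp add: sum.distrib algebra_simps)
  also have "\<dots> = (\<Sum>j<2 * n. \<Sum>k<2 * n. if j = k then complex_of_real (u $ j * u $ k) * (2 * (v \<bullet>c v)) else 0)"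
    by (intro sum.cong refl) (use v in \<open>auto simp: h_def majorana_inner_symmetrized\<close>)
  also have "\<dots> = 2 * (complex_of_real (u \<bullet> u) * (v \<bullet>c v))"
    using u by (simp add: scalar_prod_def sum_distrib_right atLeast0LessThan sum_distrib_left mult_ac)
  finally have "S = complex_of_real (u \<bullet> u) * (v \<bullet>c v)" by simp
  then have "complex_of_real ((vec_norm (field_op n u v))\<^sup>2) = complex_of_real ((u \<bullet> u) * (vec_norm v)\<^sup>2)"
    by (simp add: S_def cscalar_prod_self)
  then have "(vec_norm (field_op n u v))\<^sup>2 = (u \<bullet> u) * (vec_norm v)\<^sup>2"
    using of_real_eq_iff by blast
  then have "sqrt ((vec_norm (field_op n u v))\<^sup>2) = sqrt ((u \<bullet> u) * (vec_norm v)\<^sup>2)" by simp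
  then show ?thesis
    using vec_norm_nonneg by (simp add: real_sqrt_mult)
qed

lemma mat_trace_density:
  assumes "M \<in> carrier_mat k k" "\<psi> \<in> carrier_vec k"
  shows "mat_trace (M * density \<psi>) = (M *\<^sub>v \<psi>) \<bullet>c \<psi>"
  using assms by (simp add: mat_trace_def cscalar_prod_sum)
    (simp add: density_def scalar_prod_def sum_distrib_left mult_ac)

text \<open>The commutator has trace \<open>z - cnj z\<close>, that is
  \<open>2 * \<i> * Im z\<close>, and the prefactor reduces it to \<open>Im z\<close>. As
  \<open>\<bullet>c\<close> conjugates its second argument, the operator with index \<open>k\<close>
  stands first.\<close>

lemma correlation_matrix_density:
  assumes \<psi>: "\<psi> \<in> carrier_vec (2 ^ n)" and jk: "j < 2 * n" "k < 2 * n"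
  shows "correlation_matrix n (density \<psi>) $$ (j, k)
    = Im ((majorana n (Suc k) *\<^sub>v \<psi>) \<bullet>c (majorana n (Suc j) *\<^sub>v \<psi>))"
proof -
  define A B where "A = majorana n (Suc j)" and "B = majorana n (Suc k)"
  have \<mu>: "Suc j \<in> {1..2 * n}" "Suc k \<in> {1..2 * n}" using jk by auto
  have A: "A \<in> carrier_mat (2 ^ n) (2 ^ n)" and B: "B \<in> carrier_mat (2 ^ n) (2 ^ n)"
    unfolding A_def B_def using \<mu> majorana_carrier by blast+
  define z where "z = (B *\<^sub>v \<psi>) \<bullet>c (A *\<^sub>v \<psi>)"
  have "(A * B *\<^sub>v \<psi>) \<bullet>c \<psi> = z" "(B * A *\<^sub>v \<psi>) \<bullet>c \<psi> = (A *\<^sub>v \<psi>) \<bullet>c (B *\<^sub>v \<psi>)"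
    using A B \<psi> majorana_adjoint[OF \<mu>(1)] majorana_adjoint[OF \<mu>(2)]
      cscalar_prod_adjoint[OF A _ \<psi>, of "B *\<^sub>v \<psi>"] cscalar_prod_adjoint[OF B _ \<psi>, of "A *\<^sub>v \<psi>"]
    by (simp_all add: A_def[symmetric] B_def[symmetric] z_def)
  moreover have "(A *\<^sub>v \<psi>) \<bullet>c (B *\<^sub>v \<psi>) = cnj z"
    unfolding z_def using A B by (subst cscalar_prod_swap) auto
  moreover have "mat_trace ((A * B - B * A) * density \<psi>) = (A * B *\<^sub>v \<psi>) \<bullet>c \<psi> - (B * A *\<^sub>v \<psi>) \<bullet>c \<psi>"
    using A B \<psi> by (subst mat_trace_density[where k = "2 ^ n"])
      (auto simp: minus_mult_distrib_mat_vec[where nr = "2 ^ n" and nc = "2 ^ n"] minus_scalar_prod_distrib[where n = "2 ^ n"])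
  ultimately have "mat_trace ((A * B - B * A) * density \<psi>) = z - cnj z" by simp
  then show ?thesis
    using jk by (simp add: correlation_matrix_def Let_def A_def[symmetric] B_def[symmetric] z_def[symmetric])
qed

lemma Im_mult_of_real: "Im (complex_of_real r * z) = r * Im z"
  by simp

lemma correlation_form:
  assumes \<psi>: "\<psi> \<in> carrier_vec (2 ^ n)" and u: "u \<in> carrier_vec (2 * n)" and w: "w \<in> carrier_vec (2 * n)"
  shows "Im (field_op n w \<psi> \<bullet>c field_op n u \<psi>) = u \<bullet> (correlation_matrix n (density \<psi>) *\<^sub>v w)"
proof -
  have "Im (field_op n w \<psi> \<bullet>c field_op n u \<psi>)
      = (\<Sum>k<2 * n. \<Sum>j<2 * n. u $ j * (correlation_matrix n (density \<psi>) $$ (j, k) * w $ k))"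
    by (simp add: field_op_inner correlation_matrix_density[OF \<psi>] mult_ac Im_mult_of_real del: of_real_mult)
  also have "\<dots> = (\<Sum>j<2 * n. \<Sum>k<2 * n. u $ j * (correlation_matrix n (density \<psi>) $$ (j, k) * w $ k))"
    by (rule sum.swap)
  also have "\<dots> = u \<bullet> (correlation_matrix n (density \<psi>) *\<^sub>v w)"
    using u w by (simp add: correlation_matrix_def scalar_prod_def atLeast0LessThan sum_distrib_left)
  finally show ?thesis .
qed

section \<open>Action of Gaussian unitaries on field operators\<close>

lemma majorana_rotation_mult_vec:
  assumes "v \<in> carrier_vec (2 ^ n)" "Q \<in> carrier_mat (2 * n) (2 * n)" "j < 2 * n"
  shows "majorana_rotation n Q (Suc j) *\<^sub>v v = field_op n (row Q j) v"
proof (rule eq_vecI)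
  fix i assume "i < dim_vec (field_op n (row Q j) v)"
  then have i: "i < 2 ^ n" by simp
  have reindex: "(\<Sum>\<nu>\<in>{1..2 * n}. complex_of_real (Q $$ (j, \<nu> - 1)) * (majorana n \<nu> $$ (i, a) * v $ a))
      = (\<Sum>k<2 * n. complex_of_real (Q $$ (j, k)) * (majorana n (Suc k) $$ (i, a) * v $ a))" for a
    by (rule sum.reindex_bij_witness[of _ Suc "\<lambda>i. i - 1"]) auto
  have "(majorana_rotation n Q (Suc j) *\<^sub>v v) $ i
      = (\<Sum>a<2 ^ n. \<Sum>k<2 * n. complex_of_real (Q $$ (j, k)) * (majorana n (Suc k) $$ (i, a) * v $ a))"
    using i assms by (simp add: majorana_rotation_def scalar_prod_def atLeast0LessThan
      sum_distrib_right mult.assoc reindex[simplified])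
  also have "\<dots> = (\<Sum>k<2 * n. \<Sum>a<2 ^ n. complex_of_real (Q $$ (j, k)) * (majorana n (Suc k) $$ (i, a) * v $ a))"
    by (rule sum.swap)
  also have "\<dots> = field_op n (row Q j) v $ i"
    using i assms carrier_matD[OF majorana_carrier[of "Suc _" n]]
    by (simp add: field_op_def scalar_prod_def atLeast0LessThan sum_distrib_left)
  finally show "(majorana_rotation n Q (Suc j) *\<^sub>v v) $ i = field_op n (row Q j) v $ i" .
qed (simp add: majorana_rotation_def)

lemma orthogonal_mult_vec:
  assumes Q: "Q \<in> orthogonal_group d" and u: "u \<in> carrier_vec d"
  shows "transpose_mat Q *\<^sub>v (Q *\<^sub>v u) = u"
  using assms assoc_mult_mat_vec[of "transpose_mat Q" d d Q d u, symmetric]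
  by (simp add: orthogonal_group_def)

lemma unitary_mult_adjoint:
  assumes "unitary d U" shows "U * mat_adjoint U = 1\<^sub>m d"
proof -
  have "mat_adjoint U \<in> carrier_mat d d" "U \<in> carrier_mat d d" "mat_adjoint U * U = 1\<^sub>m d"
    using assms by (auto simp: unitary_def)
  then show ?thesis by (rule mat_mult_left_right_inverse)
qed

text \<open>The Gaussian relation, multiplied by \<open>G\<close>, moves each Majorana operator
  through \<open>G\<close> and turns it into row \<open>j\<close> of \<open>Q\<close>. Summation
  with the coefficients \<open>Q *\<^sub>v u\<close> then contracts
  \<open>transpose_mat Q * Q\<close> to the identity.\<close>

lemma field_op_gaussian:
  assumes G: "unitary (2 ^ n) G" and Q: "Q \<in> orthogonal_group (2 * n)"
    and GQ: "\<forall>\<mu>\<in>{1..2 * n}. mat_adjoint G * majorana n \<mu> * G = majorana_rotation n Q \<mu>"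
    and \<chi>: "\<chi> \<in> carrier_vec (2 ^ n)" and u: "u \<in> carrier_vec (2 * n)"
  shows "field_op n (Q *\<^sub>v u) (G *\<^sub>v \<chi>) = G *\<^sub>v field_op n u \<chi>"
proof (rule eq_vecI)
  have Gc: "G \<in> carrier_mat (2 ^ n) (2 ^ n)" using G by (simp add: unitary_def)
  have Qc: "Q \<in> carrier_mat (2 * n) (2 * n)" using Q by (simp add: orthogonal_group_def)
  show "dim_vec (field_op n (Q *\<^sub>v u) (G *\<^sub>v \<chi>)) = dim_vec (G *\<^sub>v field_op n u \<chi>)" using Gc by simp
  fix i assume "i < dim_vec (G *\<^sub>v field_op n u \<chi>)"
  then have i: "i < 2 ^ n" using Gc by simp
  have maj: "majorana n (Suc j) *\<^sub>v (G *\<^sub>v \<chi>) = G *\<^sub>v field_op n (row Q j) \<chi>" if j: "j < 2 * n" for j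
  proof -
    have M: "majorana n (Suc j) \<in> carrier_mat (2 ^ n) (2 ^ n)" using majorana_carrier j by simp
    have A: "mat_adjoint G \<in> carrier_mat (2 ^ n) (2 ^ n)" using Gc by auto
    have "G *\<^sub>v field_op n (row Q j) \<chi> = G *\<^sub>v ((mat_adjoint G * majorana n (Suc j) * G) *\<^sub>v \<chi>)"
      using GQ j majorana_rotation_mult_vec[OF \<chi> Qc j] by auto
    also have "\<dots> = (G * (mat_adjoint G * majorana n (Suc j) * G)) *\<^sub>v \<chi>"
      using Gc A M \<chi> by (intro assoc_mult_mat_vec[symmetric]) auto
    also have "G * (mat_adjoint G * majorana n (Suc j) * G) = (G * mat_adjoint G) * (majorana n (Suc j) * G)"
      using Gc A M by (simp add: assoc_mult_mat[where n\<^sub>2="2 ^ n" and n\<^sub>3="2 ^ n" and n\<^sub>4 = "2 ^ n"])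
    also have "\<dots> = majorana n (Suc j) * G"
      using unitary_mult_adjoint[OF G] M Gc by simp
    also have "\<dots> *\<^sub>v \<chi> = majorana n (Suc j) *\<^sub>v (G *\<^sub>v \<chi>)"
      using Gc M \<chi> by (intro assoc_mult_mat_vec) auto
    finally show ?thesis ..
  qed
  have col: "(\<Sum>j<2 * n. (Q *\<^sub>v u) $ j * Q $$ (j, k)) = u $ k" if k: "k < 2 * n" for k
    using arg_cong[OF orthogonal_mult_vec[OF Q u], of "\<lambda>v. v $ k"] k Qc u
    by (simp add: scalar_prod_def atLeast0LessThan mult.commute)
  have "field_op n (Q *\<^sub>v u) (G *\<^sub>v \<chi>) $ i
      = (\<Sum>j<2 * n. complex_of_real ((Q *\<^sub>v u) $ j) * (\<Sum>a<2 ^ n. G $$ (i, a) * (\<Sum>k<2 * n.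
          complex_of_real (Q $$ (j, k)) * (majorana n (Suc k) *\<^sub>v \<chi>) $ a)))"
    using i Gc Qc by (simp add: field_op_def[of n "Q *\<^sub>v u"] maj) (simp add: field_op_def scalar_prod_def atLeast0LessThan)
  also have "\<dots> = (\<Sum>j<2 * n. \<Sum>a<2 ^ n. \<Sum>k<2 * n. G $$ (i, a) * (complex_of_real ((Q *\<^sub>v u) $ j * Q $$ (j, k))
      * (majorana n (Suc k) *\<^sub>v \<chi>) $ a))"
    by (simp add: sum_distrib_left mult_ac)
  also have "\<dots> = (\<Sum>a<2 ^ n. \<Sum>k<2 * n. \<Sum>j<2 * n. G $$ (i, a) * (complex_of_real ((Q *\<^sub>v u) $ j * Q $$ (j, k))
      * (majorana n (Suc k) *\<^sub>v \<chi>) $ a))"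
    by (rule trans[OF sum.swap]) (rule sum.cong[OF refl], rule sum.swap)
  also have "\<dots> = (\<Sum>a<2 ^ n. \<Sum>k<2 * n. G $$ (i, a) * (complex_of_real (u $ k) * (majorana n (Suc k) *\<^sub>v \<chi>) $ a))"
    by (intro sum.cong refl)
      (simp only: col lessThan_iff flip: sum_distrib_left sum_distrib_right of_real_sum)
  also have "\<dots> = (G *\<^sub>v field_op n u \<chi>) $ i"
    using i Gc by (simp add: field_op_def scalar_prod_def atLeast0LessThan sum_distrib_left)
  finally show "field_op n (Q *\<^sub>v u) (G *\<^sub>v \<chi>) $ i = (G *\<^sub>v field_op n u \<chi>) $ i" .
qed

subsection \<open>Trace distance of pure states\<close>

lemma field_op_add:
  assumes "v \<in> carrier_vec (2 ^ n)" "w \<in> carrier_vec (2 ^ n)"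
  shows "field_op n u (v + w) = field_op n u v + field_op n u w"
proof (rule eq_vecI)
  have *: "majorana n (Suc j) *\<^sub>v (v + w) = majorana n (Suc j) *\<^sub>v v + majorana n (Suc j) *\<^sub>v w" if "j < 2 * n" for j
    using that assms by (intro mult_add_distrib_mat_vec[OF majorana_carrier]) auto
  show "field_op n u (v + w) $ i = (field_op n u v + field_op n u w) $ i"
    if "i < dim_vec (field_op n u v + field_op n u w)" for i
    using that by (simp add: field_op_def * algebra_simps sum.distrib)
qed simp

lemma field_op_smult:
  assumes "v \<in> carrier_vec (2 ^ n)"
  shows "field_op n u (a \<cdot>\<^sub>v v) = a \<cdot>\<^sub>v field_op n u v"
proof (rule eq_vecI)
  have *: "majorana n (Suc j) *\<^sub>v (a \<cdot>\<^sub>v v) = a \<cdot>\<^sub>v (majorana n (Suc j) *\<^sub>v v)" if "j < 2 * n" for j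
    using that assms by (intro mult_mat_vec[OF majorana_carrier]) auto
  show "field_op n u (a \<cdot>\<^sub>v v) $ i = (a \<cdot>\<^sub>v field_op n u v) $ i"
    if "i < dim_vec (a \<cdot>\<^sub>v field_op n u v)" for i
    using that by (simp add: field_op_def * sum_distrib_left mult_ac)
qed simp

lemma field_op_diff:
  assumes "v \<in> carrier_vec (2 ^ n)" "w \<in> carrier_vec (2 ^ n)"
  shows "field_op n u (v - w) = field_op n u v - field_op n u w"
proof -
  have "v - w = v + (-1) \<cdot>\<^sub>v w" using assms by (intro eq_vecI) auto
  then show ?thesis using assms
    by (auto simp: field_op_add field_op_smult intro!: eq_vecI)
qed

text \<open>The phase is \<open>cnj c / cmod c\<close>, or 1 if \<open>c = 0\<close>. It serves to
  make an overlap real and nonnegative.\<close>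

lemma unit_phase:
  fixes c :: complex
  obtains \<alpha> where "cmod \<alpha> = 1" "\<alpha> * c = cmod c"
proof (cases "c = 0")
  case False
  then have "cmod (cnj c / cmod c) = 1" "cnj c / cmod c * c = cmod c"
    by (simp_all add: norm_divide mult.commute[of "cnj c"] complex_norm_square[symmetric] power2_eq_square)
  then show ?thesis using that by blast
qed (use that[of 1] in simp)

text \<open>
  After fixing the phase of \<open>\<phi>\<close> so that the overlap \<open>r\<close> is nonnegative, polarization turns the
  difference into the form evaluated at \<open>\<phi> - \<psi>\<close> and \<open>\<phi> + \<psi>\<close>, whose norms have product
  \<open>2 sqrt (1 - r\<^sup>2)\<close>.
\<close>

lemma field_op_form_diff_le:
  assumes \<phi>: "pure_state n \<phi>" and \<psi>: "pure_state n \<psi>"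
    and u: "u \<in> carrier_vec (2 * n)" and w: "w \<in> carrier_vec (2 * n)"
  shows "Im (field_op n w \<phi> \<bullet>c field_op n u \<phi>) - Im (field_op n w \<psi> \<bullet>c field_op n u \<psi>)
    \<le> 2 * sqrt (1 - (cmod (\<phi> \<bullet>c \<psi>))\<^sup>2) * (sqrt (u \<bullet> u) * sqrt (w \<bullet> w))"
proof -
  define N where "N = (2::nat) ^ n"
  have c: "\<phi> \<in> carrier_vec N" "\<psi> \<in> carrier_vec N" and one: "\<phi> \<bullet>c \<phi> = 1" "\<psi> \<bullet>c \<psi> = 1"
    using \<phi> \<psi> by (auto simp: pure_state_def N_def)
  obtain \<alpha> where \<alpha>: "cmod \<alpha> = 1" "\<alpha> * (\<phi> \<bullet>c \<psi>) = cmod (\<phi> \<bullet>c \<psi>)" by (rule unit_phase)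
  define r where "r = cmod (\<phi> \<bullet>c \<psi>)"
  define \<phi>' where "\<phi>' = \<alpha> \<cdot>\<^sub>v \<phi>"
  have \<alpha>1: "\<alpha> * cnj \<alpha> = 1" using \<alpha>(1) by (simp add: complex_norm_square[symmetric])
  \<comment> \<open>A phase common to both arguments cancels, so passing from \<open>\<phi>\<close>
    to \<open>\<phi>'\<close> leaves the form unchanged.\<close>
  have phase: "(\<alpha> \<cdot>\<^sub>v a) \<bullet>c (\<alpha> \<cdot>\<^sub>v b) = a \<bullet>c b" if "dim_vec a = dim_vec b" for a b
  proof -
    have "(\<alpha> \<cdot>\<^sub>v a) \<bullet>c (\<alpha> \<cdot>\<^sub>v b) = (\<Sum>i<dim_vec b. (\<alpha> * cnj \<alpha>) * (a $ i * cnj (b $ i)))"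
      using that by (simp add: cscalar_prod_sum mult_ac)
    then show ?thesis using that by (simp add: \<alpha>1 cscalar_prod_sum)
  qed
  have c': "\<phi>' \<in> carrier_vec N" using c by (simp add: \<phi>'_def)
  have one': "\<phi>' \<bullet>c \<phi>' = 1" unfolding \<phi>'_def using one by (simp only: phase)
  have r1: "\<phi>' \<bullet>c \<psi> = r"
    using \<alpha>(2) c by (simp add: \<phi>'_def r_def)
  have r2: "\<psi> \<bullet>c \<phi>' = r"
    using cscalar_prod_swap[of \<phi>' \<psi>] c c' by (simp add: r1)
  define P where "P a b = field_op n w a \<bullet>c field_op n u b" for a b
  define D S where "D = \<phi>' - \<psi>" and "S = \<phi>' + \<psi>"
  have DS: "D \<in> carrier_vec N" "S \<in> carrier_vec N" using c c' by (auto simp: D_def S_def)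
  have "complex_of_real ((vec_norm D)\<^sup>2) = \<phi>' \<bullet>c \<phi>' + \<psi> \<bullet>c \<psi> - \<phi>' \<bullet>c \<psi> - \<psi> \<bullet>c \<phi>'"
    using c c' unfolding cscalar_prod_self[symmetric] D_def
    by (simp add: cscalar_prod_sum algebra_simps sum.distrib sum_subtractf)
  also have "\<dots> = complex_of_real (2 - 2 * r)" by (simp add: one one' r1 r2)
  finally have D: "(vec_norm D)\<^sup>2 = 2 - 2 * r" using of_real_eq_iff by blast
  have "complex_of_real ((vec_norm S)\<^sup>2) = \<phi>' \<bullet>c \<phi>' + \<psi> \<bullet>c \<psi> + \<phi>' \<bullet>c \<psi> + \<psi> \<bullet>c \<phi>'"
    using c c' unfolding cscalar_prod_self[symmetric] S_def
    by (simp add: cscalar_prod_sum algebra_simps sum.distrib sum_subtractf)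
  also have "\<dots> = complex_of_real (2 + 2 * r)" by (simp add: one one' r1 r2)
  finally have S: "(vec_norm S)\<^sup>2 = 2 + 2 * r" using of_real_eq_iff by blast
  have "(vec_norm D * vec_norm S)\<^sup>2 = 2\<^sup>2 * (1 - r\<^sup>2)"
    by (simp add: power_mult_distrib D S) (simp add: algebra_simps power2_eq_square)
  then have "\<bar>vec_norm D * vec_norm S\<bar> = sqrt (2\<^sup>2 * (1 - r\<^sup>2))"
    by (metis real_sqrt_abs)
  then have norms: "vec_norm D * vec_norm S = 2 * sqrt (1 - r\<^sup>2)"
    unfolding real_sqrt_mult using vec_norm_nonneg[of D] vec_norm_nonneg[of S] by simp
  have le: "cmod (P a b) \<le> sqrt (u \<bullet> u) * sqrt (w \<bullet> w) * (vec_norm a * vec_norm b)"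
    if "a \<in> carrier_vec N" "b \<in> carrier_vec N" for a b
    unfolding P_def using cscalar_prod_le[of "field_op n w a" "field_op n u b"] that u w
    by (simp add: vec_norm_field_op N_def mult_ac)
  \<comment> \<open>The mixed terms in \<open>\<phi>'\<close> and \<open>\<psi>\<close> cancel
    between the two summands.\<close>
  have "P D S + P S D = 2 * (P \<phi>' \<phi>' - P \<psi> \<psi>)"
    using c c' unfolding P_def D_def S_def N_def
    by (simp add: field_op_add field_op_diff)
      (simp add: cscalar_prod_sum algebra_simps sum.distrib sum_subtractf)
  moreover have "P \<phi>' \<phi>' = P \<phi> \<phi>"
    using c phase[of "field_op n w \<phi>" "field_op n u \<phi>"] unfolding P_def \<phi>'_def N_def
    by (simp only: field_op_smult field_op_carrier)
  ultimately have "Im (P \<phi> \<phi>) - Im (P \<psi> \<psi>) = Im (P D S + P S D) / 2" by simp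
  also have "\<dots> \<le> (cmod (P D S) + cmod (P S D)) / 2"
    using abs_Im_le_cmod[of "P D S"] abs_Im_le_cmod[of "P S D"] by simp
  also have "\<dots> \<le> sqrt (u \<bullet> u) * sqrt (w \<bullet> w) * (vec_norm D * vec_norm S)"
    using le[OF DS] le[OF DS(2,1)] by (simp add: mult_ac)
  finally show ?thesis by (simp add: P_def norms r_def mult_ac)
qed

section \<open>The trace as the sum of the eigenvalues\<close>

lemma mat_trace_comm:
  assumes "A \<in> carrier_mat n m" "B \<in> carrier_mat m n"
  shows "mat_trace (A * B) = mat_trace (B * A)"
proof -
  have "mat_trace (A * B) = (\<Sum>i<n. \<Sum>j<m. A $$ (i, j) * B $$ (j, i))"
    using assms by (simp add: mat_trace_def scalar_prod_def atLeast0LessThan)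
  also have "\<dots> = (\<Sum>j<m. \<Sum>i<n. A $$ (i, j) * B $$ (j, i))" by (rule sum.swap)
  also have "\<dots> = mat_trace (B * A)"
    using assms by (simp add: mat_trace_def scalar_prod_def atLeast0LessThan mult.commute)
  finally show ?thesis .
qed

lemma proots_prod_list_linear: "proots (\<Prod>a\<leftarrow>as. [:- a, 1:]) = mset (as :: complex list)"
proof (induction as)
  case (Cons a as)
  have "(\<Prod>a\<leftarrow>as. [:- a, 1:]) \<noteq> 0" by (auto simp: prod_list_zero_iff)
  then show ?case using Cons by (simp add: proots_mult del: mult_pCons_left)
qed simp

text \<open>Schur decomposition gives a similar triangular matrix with the roots on its diagonal,
  and the trace is invariant under similarity by cyclicity.\<close>

lemma mat_trace_eq_sum_proots:
  assumes A: "A \<in> carrier_mat n n"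
  shows "mat_trace A = \<Sum>\<^sub># (proots (char_poly A))"
proof -
  obtain as where as: "char_poly A = (\<Prod>a\<leftarrow>as. [:- a, 1:])"
    using char_poly_factorized[OF A] by blast
  obtain B P Q where BPQ: "schur_decomposition A as = (B, P, Q)" by (metis prod_cases3)
  note s = schur_decomposition[OF A as BPQ]
  from s have w: "similar_mat_wit A B P Q" by blast
  note d = similar_mat_witD2[OF A w]
  have "mat_trace A = mat_trace (P * (B * Q))" using d by (simp add: assoc_mult_mat[where n\<^sub>2 = n and n\<^sub>3 = n and n\<^sub>4 = n])
  also have "\<dots> = mat_trace ((B * Q) * P)" using d by (intro mat_trace_comm) auto
  also have "(B * Q) * P = B" using d by (simp add: assoc_mult_mat[where n\<^sub>2 = n and n\<^sub>3 = n and n\<^sub>4 = n])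
  also have "mat_trace B = sum_list (diag_mat B)"
    by (simp add: mat_trace_def diag_mat_def interv_sum_list_conv_sum_set_nat atLeast0LessThan)
  finally show ?thesis using s by (simp add: as proots_prod_list_linear sum_mset_sum_list)
qed

lemma Re_sum_mset: "Re (\<Sum>\<^sub># M) = (\<Sum>x\<in>#M. Re x)"
  by (induction M) auto

text \<open>Cauchy-Schwarz for unit vectors. It keeps the expression under the square root in the
  trace distance nonnegative.\<close>

lemma cmod_cscalar_prod_pure_le:
  assumes "pure_state n \<phi>" "pure_state n \<psi>"
  shows "cmod (\<phi> \<bullet>c \<psi>) \<le> 1"
proof -
  have "vec_norm v = 1" if "pure_state n v" for v
  proof -
    have "complex_of_real ((vec_norm v)\<^sup>2) = of_real 1"
      using that cscalar_prod_self[of v] by (simp add: pure_state_def)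
    then have "(vec_norm v)\<^sup>2 = 1" using of_real_eq_iff by blast
    then show ?thesis using vec_norm_nonneg[of v] by (simp add: power2_eq_1_iff)
  qed
  then show ?thesis
    using cscalar_prod_le[of \<phi> \<psi>] assms by (auto simp: pure_state_def)
qed

text \<open>
  The square \<open>B\<close> of the difference satisfies \<open>B B = s\<^sup>2 B\<close> and has trace \<open>2 s\<^sup>2\<close>, where \<open>s\<close> is the
  right-hand side: its eigenvalues are \<open>0\<close> and \<open>s\<^sup>2\<close>, so their square roots add up to \<open>2 s\<close>.
\<close>

lemma trace_distance_pure_states:
  assumes \<psi>: "pure_state n \<psi>" and \<phi>: "pure_state n \<phi>"
  shows "trace_distance (density \<psi>) (density \<phi>) = sqrt (1 - (cmod (\<phi> \<bullet>c \<psi>))\<^sup>2)"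
proof -
  define N where "N = (2::nat) ^ n"
  have c: "\<phi> \<in> carrier_vec N" "\<psi> \<in> carrier_vec N" and one: "\<phi> \<bullet>c \<phi> = 1" "\<psi> \<bullet>c \<psi> = 1"
    using \<phi> \<psi> by (auto simp: pure_state_def N_def)
  define z where "z = \<phi> \<bullet>c \<psi>"
  define s where "s = sqrt (1 - (cmod z)\<^sup>2)"
  have "(cmod z)\<^sup>2 \<le> 1"
    using cmod_cscalar_prod_pure_le[OF \<phi> \<psi>] by (simp add: z_def power_le_one)
  then have s: "s \<ge> 0" "complex_of_real (s\<^sup>2) = 1 - z * cnj z"
    by (simp_all add: s_def complex_norm_square[symmetric])
  have sums: "(\<Sum>k<N. \<phi> $ k * cnj (\<psi> $ k)) = z" "(\<Sum>k<N. \<psi> $ k * cnj (\<phi> $ k)) = cnj z"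
    "(\<Sum>k<N. \<phi> $ k * cnj (\<phi> $ k)) = 1" "(\<Sum>k<N. \<psi> $ k * cnj (\<psi> $ k)) = 1"
    using c one cscalar_prod_swap[of \<phi> \<psi>] by (auto simp: cscalar_prod_sum z_def)
  define A where "A = density \<psi> - density \<phi>"
  have A: "A \<in> carrier_mat N N" using c by (auto simp: A_def density_def)
  have Aij: "A $$ (i, j) = \<psi> $ i * cnj (\<psi> $ j) - \<phi> $ i * cnj (\<phi> $ j)" if "i < N" "j < N" for i j
    using that c by (simp add: A_def density_def)
  have herm: "mat_adjoint A = A"
    using A by (intro eq_matI) (auto simp: Aij mult.commute)
  \<comment> \<open>The entries of \<open>B\<close> and of \<open>B * B\<close> have this shape,
    since rows and columns of the factors are combinations of the two states.\<close>
  have sum4: "(\<Sum>k<N. (a * cnj (\<psi> $ k) + b * cnj (\<phi> $ k)) * (\<psi> $ k * d + \<phi> $ k * e))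
      = a * d + a * e * z + b * d * cnj z + b * e" for a b d e
  proof -
    have "(\<Sum>k<N. (a * cnj (\<psi> $ k) + b * cnj (\<phi> $ k)) * (\<psi> $ k * d + \<phi> $ k * e))
      = a * d * (\<Sum>k<N. \<psi> $ k * cnj (\<psi> $ k)) + a * e * (\<Sum>k<N. \<phi> $ k * cnj (\<psi> $ k))
      + b * d * (\<Sum>k<N. \<psi> $ k * cnj (\<phi> $ k)) + b * e * (\<Sum>k<N. \<phi> $ k * cnj (\<phi> $ k))"
      by (simp only: sum_distrib_left flip: sum.distrib) (simp add: algebra_simps)
    then show ?thesis by (simp add: sums)
  qed
  define B where "B = mat_adjoint A * A"
  have B: "B \<in> carrier_mat N N" using A by (auto simp: B_def herm)
  have Bij: "B $$ (i, j) = \<psi> $ i * cnj (\<psi> $ j) + \<phi> $ i * cnj (\<phi> $ j)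
      - z * \<psi> $ i * cnj (\<phi> $ j) - cnj z * \<phi> $ i * cnj (\<psi> $ j)" if "i < N" "j < N" for i j
  proof -
    have "B $$ (i, j) = (\<Sum>k<N. (\<psi> $ i * cnj (\<psi> $ k) + (- \<phi> $ i) * cnj (\<phi> $ k)) *
        (\<psi> $ k * cnj (\<psi> $ j) + \<phi> $ k * (- cnj (\<phi> $ j))))"
      using that A by (simp add: B_def herm scalar_prod_def atLeast0LessThan Aij)
    then show ?thesis unfolding sum4 by (simp add: algebra_simps)
  qed
  have BB: "B * B = complex_of_real (s\<^sup>2) \<cdot>\<^sub>m B"
  proof (rule eq_matI)
    fix i j assume "i < dim_row (complex_of_real (s\<^sup>2) \<cdot>\<^sub>m B)" "j < dim_col (complex_of_real (s\<^sup>2) \<cdot>\<^sub>m B)"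
    then have ij: "i < N" "j < N" using B by auto
    have "(B * B) $$ (i, j) = (\<Sum>k<N. ((\<psi> $ i - cnj z * \<phi> $ i) * cnj (\<psi> $ k) + (\<phi> $ i - z * \<psi> $ i) * cnj (\<phi> $ k)) *
        (\<psi> $ k * (cnj (\<psi> $ j) - z * cnj (\<phi> $ j)) + \<phi> $ k * (cnj (\<phi> $ j) - cnj z * cnj (\<psi> $ j))))"
      using ij B by (simp add: scalar_prod_def atLeast0LessThan Bij)
        (simp add: algebra_simps)
    also have "\<dots> = (1 - z * cnj z) * B $$ (i, j)"
      unfolding sum4 Bij[OF ij] by (simp add: algebra_simps)
    finally show "(B * B) $$ (i, j) = (complex_of_real (s\<^sup>2) \<cdot>\<^sub>m B) $$ (i, j)"
      using ij B s by simp
  qed (use B in auto)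
  have trB: "mat_trace B = 2 * complex_of_real (s\<^sup>2)"
  proof -
    have "mat_trace B = (\<Sum>i<N. \<psi> $ i * cnj (\<psi> $ i)) + (\<Sum>i<N. \<phi> $ i * cnj (\<phi> $ i))
       - z * (\<Sum>i<N. \<psi> $ i * cnj (\<phi> $ i)) - cnj z * (\<Sum>i<N. \<phi> $ i * cnj (\<psi> $ i))"
      using B by (simp add: mat_trace_def Bij sum.distrib sum_subtractf sum_distrib_left mult.assoc)
    then show ?thesis unfolding s(2) by (simp add: sums mult.commute)
  qed
  \<comment> \<open>Applied to an eigenvector, \<open>BB\<close> becomes
    \<open>x * x = s\<^sup>2 * x\<close>.\<close>
  have roots: "x = 0 \<or> x = complex_of_real (s\<^sup>2)" if "x \<in># proots (char_poly B)" for x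
  proof -
    have "char_poly B \<noteq> 0" using degree_monic_char_poly[OF B] by auto
    then have "eigenvalue B x"
      using that eigenvalue_root_char_poly[OF B] by simp
    then obtain v where v: "v \<in> carrier_vec N" "v \<noteq> 0\<^sub>v N" "B *\<^sub>v v = x \<cdot>\<^sub>v v"
      using B by (auto simp: eigenvalue_def eigenvector_def)
    have "(B * B) *\<^sub>v v = x \<cdot>\<^sub>v (x \<cdot>\<^sub>v v)"
      using v by (simp add: assoc_mult_mat_vec[OF B B v(1)] mult_mat_vec[OF B v(1)])
    moreover have "(B * B) *\<^sub>v v = complex_of_real (s\<^sup>2) \<cdot>\<^sub>v (x \<cdot>\<^sub>v v)"
      unfolding BB v(3)[symmetric] using B v(1) by (intro eq_vecI) auto
    moreover obtain i where i: "i < N" "v $ i \<noteq> 0" using v by (auto simp: vec_eq_iff)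
    ultimately have "x * (x * v $ i) = complex_of_real (s\<^sup>2) * (x * v $ i)"
      using v by (metis carrier_vecD index_smult_vec(1) smult_carrier_vec)
    then show ?thesis using i by auto
  qed
  have tn: "trace_norm A = (\<Sum>x\<in>#proots (char_poly B). sqrt (Re x))"
    by (simp add: trace_norm_def B_def)
  have "trace_norm A = 2 * s"
  \<comment> \<open>For \<open>s = 0\<close> all roots vanish. Otherwise
    \<open>s * sqrt (Re x) = Re x\<close> on the roots reduces \<open>s\<close> times the norm to
    the trace \<open>2 * s\<^sup>2\<close>, and one factor \<open>s\<close> cancels.\<close>
  proof (cases "s = 0")
    case True
    then have "(\<Sum>x\<in>#proots (char_poly B). sqrt (Re x)) = (\<Sum>x\<in>#proots (char_poly B). 0)"
      using roots by (intro arg_cong[where f = sum_mset] image_mset_cong) fastforce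
    then show ?thesis using True by (simp add: tn)
  next
    case False
    have "s * sqrt (Re x) = Re x" if "x \<in># proots (char_poly B)" for x
      using roots[OF that] s(1) by (auto simp: power2_eq_square)
    then have "s * trace_norm A = (\<Sum>x\<in>#proots (char_poly B). Re x)"
      unfolding tn sum_mset_distrib_left by (intro arg_cong[where f = sum_mset] image_mset_cong) simp
    also have "\<dots> = Re (\<Sum>\<^sub># (proots (char_poly B)))"
      by (simp add: Re_sum_mset)
    also have "\<dots> = s * (2 * s)"
      by (simp add: mat_trace_eq_sum_proots[OF B, symmetric] trB power2_eq_square)
    finally show ?thesis using False by simp
  qed
  then show ?thesis by (simp add: trace_distance_def A_def s_def z_def)
qed

subsection \<open>Compactness of the compressible states\<close>

lemma kron_vec_zero_state_cscalar_prod_self: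
  assumes "\<phi> \<in> carrier_vec k"
  shows "kron_vec \<phi> (zero_state m) \<bullet>c kron_vec \<phi> (zero_state m) = \<phi> \<bullet>c \<phi>"
proof -
  have "kron_vec \<phi> (zero_state m) \<bullet>c kron_vec \<phi> (zero_state m)
      = (\<Sum>s<k * 2 ^ m. (\<lambda>x y. if y = 0 then \<phi> $ x * cnj (\<phi> $ x) else 0) (s div 2 ^ m) (s mod 2 ^ m))"
    using assms by (simp add: cscalar_prod_sum) (auto simp: kron_vec_def zero_state_def intro!: sum.cong)
  also have "\<dots> = (\<Sum>x<k. \<Sum>y<(2::nat) ^ m. if y = 0 then \<phi> $ x * cnj (\<phi> $ x) else 0)"
    by (rule sum_div_mod) simp
  finally show ?thesis using assms by (simp add: cscalar_prod_sum)
qed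

lemma kron_vec_zero_state_carrier:
  "t \<le> n \<Longrightarrow> \<phi> \<in> carrier_vec (2 ^ t) \<Longrightarrow> kron_vec \<phi> (zero_state (n - t)) \<in> carrier_vec (2 ^ n)"
  using kron_vec_carrier[OF _ zero_state_carrier, of \<phi> "2 ^ t" "n - t"] by (simp flip: power_add)

lemma unitary_cscalar_prod_self:
  assumes U: "unitary k U" and v: "v \<in> carrier_vec k"
  shows "(U *\<^sub>v v) \<bullet>c (U *\<^sub>v v) = v \<bullet>c v"
proof -
  have c: "U \<in> carrier_mat k k" "mat_adjoint U \<in> carrier_mat k k" using U by (auto simp: unitary_def)
  then have "mat_adjoint U *\<^sub>v (U *\<^sub>v v) = v"
    using U v assoc_mult_mat_vec[of "mat_adjoint U" k k U k v, symmetric] by (simp add: unitary_def)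
  then show ?thesis using c v cscalar_prod_adjoint[of U k k v "U *\<^sub>v v"] by simp
qed

lemma compressible_states_pure:
  assumes "t \<le> n" "\<phi> \<in> compressible_states n t"
  shows "pure_state n \<phi>"
proof -
  obtain G \<phi>0 where *: "\<phi> = G *\<^sub>v kron_vec \<phi>0 (zero_state (n - t))" "gaussian_unitary n G" "pure_state t \<phi>0"
    using assms by (auto simp: compressible_states_def)
  then have "kron_vec \<phi>0 (zero_state (n - t)) \<in> carrier_vec (2 ^ n)" "unitary (2 ^ n) G"
    using kron_vec_zero_state_carrier[OF assms(1)] by (auto simp: pure_state_def gaussian_unitary_def)
  then show ?thesis
    using * unitary_cscalar_prod_self[of "2 ^ n" G] kron_vec_zero_state_cscalar_prod_self[of \<phi>0 "2 ^ t"]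
    by (auto simp: pure_state_def unitary_def intro!: mult_mat_vec_carrier)
qed

text \<open>Serves to show that compressible states exist, which attainment of a maximum
  requires.\<close>

lemma gaussian_unitary_one: "gaussian_unitary n (1\<^sub>m (2 ^ n))"
  unfolding gaussian_unitary_def
proof (intro conjI bexI ballI)
  show "unitary (2 ^ n) (1\<^sub>m (2 ^ n))" by (simp add: unitary_def mat_adjoint_one)
  show "1\<^sub>m (2 * n) \<in> orthogonal_group (2 * n)" by (simp add: orthogonal_group_def)
  fix \<mu> assume \<mu>: "\<mu> \<in> {1..2 * n}"
  note c = majorana_carrier[OF \<mu>]
  have "(\<Sum>\<nu>\<in>{1..2 * n}. complex_of_real (1\<^sub>m (2 * n) $$ (\<mu> - 1, \<nu> - 1)) * majorana n \<nu> $$ ij)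
      = (\<Sum>\<nu>\<in>{1..2 * n}. if \<nu> = \<mu> then majorana n \<nu> $$ ij else 0)" for ij
    using \<mu> by (intro sum.cong refl) auto
  then have "majorana_rotation n (1\<^sub>m (2 * n)) \<mu> = majorana n \<mu>"
    using c \<mu> by (intro eq_matI) (auto simp: majorana_rotation_def)
  then show "mat_adjoint (1\<^sub>m (2 ^ n)) * majorana n \<mu> * 1\<^sub>m (2 ^ n) = majorana_rotation n (1\<^sub>m (2 * n)) \<mu>"
    using c by (simp add: mat_adjoint_one)
qed

lemma compressible_states_nonempty: "compressible_states n t \<noteq> {}"
proof -
  have "pure_state t (unit_vec (2 ^ t) 0)" by (simp add: pure_state_def)
  then show ?thesis using gaussian_unitary_one by (auto simp: compressible_states_def)
qed

text \<open>Tychonoff's theorem, transferred from the abstract product topology to the function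
  type.\<close>

lemma compact_Pi_UNIV:
  fixes S :: "'b::topological_space set"
  assumes "compact S"
  shows "compact {f :: 'a \<Rightarrow> 'b. \<forall>i. f i \<in> S}"
proof -
  have "compactin (product_topology (\<lambda>i. euclidean) UNIV) (PiE UNIV (\<lambda>i::'a. S))"
    using assms by (simp add: compactin_PiE)
  moreover have "PiE UNIV (\<lambda>i::'a. S) = {f. \<forall>i. f i \<in> S}" by (auto simp: PiE_def Pi_def)
  ultimately show ?thesis by (simp add: euclidean_product_topology)
qed

text \<open>A compact set containing the closed unit disc; the square shape makes it a continuous
  image of a product of two real intervals.\<close>

definition unit_square :: "complex set" where
  "unit_square = {z. \<bar>Re z\<bar> \<le> 1 \<and> \<bar>Im z\<bar> \<le> 1}"

lemma compact_unit_square: "compact unit_square"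
proof -
  have eq: "unit_square = (\<lambda>(x, y). complex_of_real x + \<i> * complex_of_real y) ` ({-1..1} \<times> {-1..1})"
  proof (intro equalityI subsetI)
    fix z assume "z \<in> unit_square"
    then show "z \<in> (\<lambda>(x, y). complex_of_real x + \<i> * complex_of_real y) ` ({-1..1} \<times> {-1..1})"
      by (intro image_eqI[of _ _ "(Re z, Im z)"]) (auto simp: unit_square_def complex_eq_iff)
  qed (auto simp: unit_square_def)
  show ?thesis
    unfolding eq case_prod_unfold by (intro compact_continuous_image compact_Times compact_Icc continuous_intros)
qed

text \<open>Each squared modulus is one term of a nonnegative sum with value 1.\<close>

lemma unit_square_of_sum_le:
  assumes "(\<Sum>k\<in>A. z k * cnj (z k)) = 1" "finite A" "j \<in> A"
  shows "z j \<in> unit_square"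
proof -
  have "complex_of_real (\<Sum>k\<in>A. (cmod (z k))\<^sup>2) = of_real 1" using assms(1) by (simp add: complex_norm_square del: of_real_power)
  then have "(\<Sum>k\<in>A. (cmod (z k))\<^sup>2) = 1" using of_real_eq_iff by blast
  then have "(cmod (z j))\<^sup>2 \<le> 1" using member_le_sum[of j A "\<lambda>k. (cmod (z k))\<^sup>2"] assms by auto
  then have "cmod (z j) \<le> 1" by (simp add: power2_le_iff_abs_le power_le_one_iff abs_square_le_1)
  then show ?thesis using abs_Re_le_cmod[of "z j"] abs_Im_le_cmod[of "z j"] by (simp add: unit_square_def)
qed

text \<open>The set \<open>box\<close> bounds all coordinates and \<open>K\<close> is cut out by
  equations between continuous functions, so \<open>box \<inter> K\<close> is compact. Keeping the
  rotation as a coordinate avoids an existential quantifier in the description of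
  \<open>K\<close>.\<close>

lemma ex_max_overlap:
  assumes "t \<le> n" and \<psi>: "\<psi> \<in> carrier_vec (2 ^ n)"
  shows "\<exists>\<phi>\<in>compressible_states n t. \<forall>\<phi>'\<in>compressible_states n t. cmod (\<phi>' \<bullet>c \<psi>) \<le> cmod (\<phi> \<bullet>c \<psi>)"
proof -
  define N T m where "N = (2::nat) ^ n" and "T = (2::nat) ^ t" and "m = 2 * n"
  txt \<open>A state is parametrized by all entries of the Gaussian unitary, of its rotation and of the
    compressed state, in a product space whose coordinates outside the matrices are irrelevant.\<close>
  define G :: "(nat \<times> nat \<Rightarrow> complex) \<times> (nat \<times> nat \<Rightarrow> real) \<times> (nat \<Rightarrow> complex) \<Rightarrow> complex mat"
    where "G x = mat N N (fst x)" for x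
  define Q :: "(nat \<times> nat \<Rightarrow> complex) \<times> (nat \<times> nat \<Rightarrow> real) \<times> (nat \<Rightarrow> complex) \<Rightarrow> real mat"
    where "Q x = mat m m (fst (snd x))" for x
  define V :: "(nat \<times> nat \<Rightarrow> complex) \<times> (nat \<times> nat \<Rightarrow> real) \<times> (nat \<Rightarrow> complex) \<Rightarrow> complex vec"
    where "V x = vec T (snd (snd x))" for x
  define state where "state x = G x *\<^sub>v kron_vec (V x) (zero_state (n - t))" for x
  have cont[continuous_intros]: "continuous_on A (\<lambda>x. fst x i)" "continuous_on A (\<lambda>x. fst (snd x) i)"
    "continuous_on A (\<lambda>x. snd (snd x) j)"
    for A :: "((nat \<times> nat \<Rightarrow> complex) \<times> (nat \<times> nat \<Rightarrow> real) \<times> (nat \<Rightarrow> complex)) set" and i j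
    by (rule continuous_on_product_then_coordinatewise, intro continuous_intros)+
  define box where "box = {g :: nat \<times> nat \<Rightarrow> complex. \<forall>i. g i \<in> unit_square} \<times>
    {q :: nat \<times> nat \<Rightarrow> real. \<forall>i. q i \<in> {-1..1}} \<times> {p :: nat \<Rightarrow> complex. \<forall>i. p i \<in> unit_square}"
  have box: "compact box"
    unfolding box_def by (intro compact_Times compact_Pi_UNIV compact_unit_square compact_Icc)
  define K where "K = {x. unitary N (G x) \<and> Q x \<in> orthogonal_group m \<and> pure_state t (V x) \<and>
    (\<forall>\<mu>\<in>{1..2 * n}. mat_adjoint (G x) * majorana n \<mu> * G x = majorana_rotation n (Q x) \<mu>)}"
  \<comment> \<open>\<open>U\<close>, \<open>O\<close>, \<open>P\<close> and \<open>R\<close> spell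
    out the matrix conditions entry by entry, in the form needed for closedness.\<close>
  have U: "unitary N (G x) \<longleftrightarrow> (\<forall>i. i < N \<longrightarrow> (\<forall>j. j < N \<longrightarrow>
      (\<Sum>k<N. cnj (fst x (k, i)) * fst x (k, j)) = (if i = j then 1 else 0)))" for x
    by (auto simp: unitary_def mat_eq_iff G_def scalar_prod_def atLeast0LessThan)
  have O: "Q x \<in> orthogonal_group m \<longleftrightarrow> (\<forall>i. i < m \<longrightarrow> (\<forall>j. j < m \<longrightarrow>
      (\<Sum>k<m. fst (snd x) (k, i) * fst (snd x) (k, j)) = (if i = j then 1 else 0)))" for x
    by (auto simp: orthogonal_group_def mat_eq_iff Q_def scalar_prod_def atLeast0LessThan)
  have P: "pure_state t (V x) \<longleftrightarrow> (\<Sum>k<T. snd (snd x) k * cnj (snd (snd x) k)) = 1" for x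
    by (simp add: pure_state_def cscalar_prod_sum V_def T_def)
  have R: "(mat_adjoint (G x) * majorana n \<mu> * G x = majorana_rotation n (Q x) \<mu>) \<longleftrightarrow>
      (\<forall>i. i < N \<longrightarrow> (\<forall>j. j < N \<longrightarrow>
        (\<Sum>l<N. (\<Sum>k<N. cnj (fst x (k, i)) * majorana n \<mu> $$ (k, l)) * fst x (l, j))
         = (\<Sum>\<nu>\<in>{1..2 * n}. complex_of_real (fst (snd x) (\<mu> - 1, \<nu> - 1)) * majorana n \<nu> $$ (i, j))))"
    if \<mu>: "\<mu> \<in> {1..2 * n}" for x \<mu>
  proof -
    have "(\<Sum>\<nu>\<in>{1..2 * n}. complex_of_real (Q x $$ (\<mu> - 1, \<nu> - 1)) * majorana n \<nu> $$ (i, j))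
        = (\<Sum>\<nu>\<in>{1..2 * n}. complex_of_real (fst (snd x) (\<mu> - 1, \<nu> - 1)) * majorana n \<nu> $$ (i, j))" for i j
      using \<mu> by (intro sum.cong refl) (auto simp: Q_def m_def)
    moreover note majorana_carrier[OF \<mu>]
    ultimately show ?thesis
      by (simp add: mat_eq_iff majorana_rotation_def G_def N_def)
        (simp add: scalar_prod_def atLeast0LessThan)
  qed
  have "closed K"
    unfolding K_def Ball_def U O P
    \<comment> \<open>\<open>R\<close> holds only for \<open>\<mu>\<close> in range; the congruence
      rules make that hypothesis available.\<close>
    by (simp only: R imp_conjL cong: conj_cong imp_cong)
      (intro closed_Collect_conj closed_Collect_all closed_Collect_imp open_Collect_const closed_Collect_eq continuous_intros)
  then have comp: "compact (box \<inter> K)" by (rule compact_Int_closed[OF box])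
  have image: "compressible_states n t = state ` (box \<inter> K)"
  proof (intro equalityI subsetI)
    fix \<phi> assume "\<phi> \<in> state ` (box \<inter> K)"
    then obtain x where "x \<in> K" "\<phi> = state x" by auto
    then show "\<phi> \<in> compressible_states n t"
      unfolding compressible_states_def gaussian_unitary_def K_def state_def N_def m_def by blast
  next
    fix \<phi> assume "\<phi> \<in> compressible_states n t"
    then obtain G' Q' \<phi>0 where \<phi>: "\<phi> = G' *\<^sub>v kron_vec \<phi>0 (zero_state (n - t))"
      and G': "unitary N G'" and Q': "Q' \<in> orthogonal_group m" and \<phi>0: "pure_state t \<phi>0"
      and GQ: "\<forall>\<mu>\<in>{1..2 * n}. mat_adjoint G' * majorana n \<mu> * G' = majorana_rotation n Q' \<mu>"
      unfolding compressible_states_def gaussian_unitary_def N_def m_def by blast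
    \<comment> \<open>Coordinates outside the matrices get the value 0, which keeps the point inside
      \<open>box\<close>.\<close>
    define x where "x = ((\<lambda>(i, j). if i < N \<and> j < N then G' $$ (i, j) else 0),
      (\<lambda>(i, j). if i < m \<and> j < m then Q' $$ (i, j) else 0), (\<lambda>i. if i < T then \<phi>0 $ i else 0))"
    have x: "G x = G'" "Q x = Q'" "V x = \<phi>0"
      using G' Q' \<phi>0 by (auto simp: G_def Q_def V_def x_def unitary_def orthogonal_group_def pure_state_def T_def
        intro!: eq_matI eq_vecI)
    then have K: "x \<in> K" using G' Q' \<phi>0 GQ by (simp add: K_def)
    have zero: "0 \<in> unit_square" by (simp add: unit_square_def)
    have "fst x i \<in> unit_square" for i
    proof (cases "fst i < N \<and> snd i < N")
      case True
      then have "(\<Sum>k<N. fst x (k, snd i) * cnj (fst x (k, snd i))) = 1"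
        using K by (simp add: K_def U mult.commute)
      then have "fst x (fst i, snd i) \<in> unit_square"
        using True by (intro unit_square_of_sum_le[where A = "{..<N}" and z = "\<lambda>k. fst x (k, snd i)"]) auto
      then show ?thesis by simp
    qed (use zero in \<open>auto simp: x_def case_prod_unfold\<close>)
    moreover have "fst (snd x) i \<in> {-1..1}" for i
    proof (cases "fst i < m \<and> snd i < m")
      case True
      then have "(\<Sum>k<m. (fst (snd x) (k, snd i))\<^sup>2) = 1"
        using K by (simp add: K_def O power2_eq_square)
      then have "(fst (snd x) (fst i, snd i))\<^sup>2 \<le> 1"
        using member_le_sum[of "fst i" "{..<m}" "\<lambda>k. (fst (snd x) (k, snd i))\<^sup>2"] True by auto
      then show ?thesis by (simp add: abs_square_le_1 abs_le_iff)
    qed (auto simp: x_def case_prod_unfold)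
    moreover have "snd (snd x) i \<in> unit_square" for i
    proof (cases "i < T")
      case True
      have "(\<Sum>k<T. snd (snd x) k * cnj (snd (snd x) k)) = 1"
        using K by (simp add: K_def P)
      then show ?thesis
        using True by (intro unit_square_of_sum_le[where A = "{..<T}" and z = "\<lambda>k. snd (snd x) k"]) auto
    qed (use zero in \<open>auto simp: x_def\<close>)
    ultimately have "x \<in> box" by (cases x) (auto simp: box_def)
    then show "\<phi> \<in> state ` (box \<inter> K)"
      using K x \<phi> by (auto simp: state_def intro!: image_eqI[of _ _ x])
  qed
  have NT: "N = T * 2 ^ (n - t)" using assms(1) by (simp add: N_def T_def flip: power_add)
  \<comment> \<open>In coordinates the overlap is a polynomial, so its continuity becomes
    syntactic.\<close>
  have overlap: "cmod (state x \<bullet>c \<psi>) = cmod (\<Sum>i<N. (\<Sum>j<N. fst x (i, j) *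
      (snd (snd x) (j div 2 ^ (n - t)) * zero_state (n - t) $ (j mod 2 ^ (n - t)))) * cnj (\<psi> $ i))" for x
  proof -
    have "kron_vec (V x) (zero_state (n - t)) $ j
        = snd (snd x) (j div 2 ^ (n - t)) * zero_state (n - t) $ (j mod 2 ^ (n - t))" if "j < N" for j
      using that less_mult_imp_div_less[of j T "2 ^ (n - t)"] zero_state_carrier[of "n - t"] NT
      by (simp add: kron_vec_def V_def)
    moreover have "kron_vec (V x) (zero_state (n - t)) \<in> carrier_vec N"
      using kron_vec_zero_state_carrier[OF assms(1), of "V x"] by (simp add: V_def T_def N_def)
    ultimately show ?thesis
      using \<psi> unfolding state_def
      by (subst cscalar_prod_sum) (auto simp: G_def scalar_prod_def atLeast0LessThan N_def)
  qed
  have "continuous_on (box \<inter> K) (\<lambda>x. cmod (state x \<bullet>c \<psi>))"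
    unfolding overlap by (intro continuous_intros)
  moreover have "box \<inter> K \<noteq> {}" using image compressible_states_nonempty[of n t] by auto
  ultimately show ?thesis
    using continuous_attains_sup[OF comp] by (auto simp: image)
qed

subsection \<open>The overlap bound\<close>

text \<open>Groups the \<open>2 * n\<close> Majorana coordinates by modes.\<close>

lemma sum_lessThan_double:
  fixes f :: "nat \<Rightarrow> 'a::comm_monoid_add"
  shows "(\<Sum>i<2 * n. f i) = (\<Sum>k<n. f (2 * k) + f (Suc (2 * k)))"
  by (induction n) (simp_all add: add.assoc)

text \<open>
  On a mode in state 0 one has \<open>Y = \<i> X\<close>, so the contribution of mode \<open>k\<close> to \<open>\<gamma>(w)\<close> depends only on
  \<open>w $ (2 * k) + \<i> * w $ (2 * k + 1)\<close>; the twist multiplies these numbers by \<open>-\<i>\<close>.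
\<close>

definition twist :: "real vec \<Rightarrow> real vec" where
  "twist w = vec (dim_vec w) (\<lambda>i. if even i then w $ Suc i else - w $ (i - 1))"

lemma twist_index:
  assumes "w \<in> carrier_vec (2 * n)" "k < n"
  shows "twist w $ (2 * k) = w $ Suc (2 * k)" "twist w $ Suc (2 * k) = - w $ (2 * k)"
  using assms by (auto simp: twist_def)

lemma twist_carrier: "w \<in> carrier_vec m \<Longrightarrow> twist w \<in> carrier_vec m"
  by (simp add: twist_def)

lemma scalar_prod_twist:
  assumes w: "w \<in> carrier_vec (2 * n)"
  shows "twist w \<bullet> twist w = w \<bullet> w"
  using w twist_carrier[OF w]
  by (simp add: scalar_prod_def atLeast0LessThan sum_lessThan_double twist_index[OF w] add.commute)

text \<open>Compared mode by mode: below \<open>t\<close> both \<open>w\<close> and its twist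
  vanish, and from \<open>t\<close> on \<open>majorana_zero_state\<close> expresses the second
  operator of the mode by the first.\<close>

lemma field_op_twist:
  assumes "t \<le> n" and \<phi>: "\<phi> \<in> carrier_vec (2 ^ t)" and w: "w \<in> carrier_vec (2 * n)"
    and w0: "\<And>i. i < 2 * t \<Longrightarrow> w $ i = 0"
  defines "\<chi> \<equiv> kron_vec \<phi> (zero_state (n - t))"
  shows "field_op n (twist w) \<chi> = - \<i> \<cdot>\<^sub>v field_op n w \<chi>"
proof (rule eq_vecI)
  fix i assume "i < dim_vec (- \<i> \<cdot>\<^sub>v field_op n w \<chi>)"
  then have i: "i < 2 ^ n" by simp
  let ?g = "\<lambda>j. (majorana n (Suc j) *\<^sub>v \<chi>) $ i"
  have pair: "complex_of_real (twist w $ (2 * k)) * ?g (2 * k) + complex_of_real (twist w $ Suc (2 * k)) * ?g (Suc (2 * k))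
     = - \<i> * (complex_of_real (w $ (2 * k)) * ?g (2 * k) + complex_of_real (w $ Suc (2 * k)) * ?g (Suc (2 * k)))"
    if k: "k < n" for k
  proof (cases "k < t")
    case True
    then show ?thesis using k by (simp add: twist_index[OF w] w0)
  next
    case False
    have c: "majorana n (Suc (2 * k)) \<in> carrier_mat (2 ^ n) (2 ^ n)"
      using k by (intro majorana_carrier) auto
    have "?g (Suc (2 * k)) = \<i> * ?g (2 * k)"
      using majorana_zero_state[of t k n \<phi>] False k \<phi> i c by (simp add: \<chi>_def)
    then show ?thesis using k by (simp add: twist_index[OF w]) (simp add: algebra_simps)
  qed
  have "(\<Sum>k<n. complex_of_real (twist w $ (2 * k)) * ?g (2 * k) + complex_of_real (twist w $ Suc (2 * k)) * ?g (Suc (2 * k)))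
     = - \<i> * (\<Sum>k<n. complex_of_real (w $ (2 * k)) * ?g (2 * k) + complex_of_real (w $ Suc (2 * k)) * ?g (Suc (2 * k)))"
    by (subst sum_distrib_left, rule sum.cong[OF refl], rule pair) simp
  then show "field_op n (twist w) \<chi> $ i = (- \<i> \<cdot>\<^sub>v field_op n w \<chi>) $ i"
    using i by (simp add: field_op_def sum_lessThan_double del: index_mult_mat_vec)
qed simp

section \<open>The normal form and its bilinear form\<close>

lemma diag_block_mat_2:
  assumes "\<And>k. k \<in> set ks \<Longrightarrow> B k \<in> carrier_mat 2 2"
  shows "diag_block_mat (map B ks) \<in> carrier_mat (2 * length ks) (2 * length ks) \<and>
    (\<forall>i<2 * length ks. \<forall>j<2 * length ks. diag_block_mat (map B ks) $$ (i, j) =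
      (if i div 2 = j div 2 then B (ks ! (i div 2)) $$ (i mod 2, j mod 2) else 0))"
  using assms
proof (induction ks)
  case (Cons k ks)
  let ?D = "diag_block_mat (map B ks)"
  have D: "?D \<in> carrier_mat (2 * length ks) (2 * length ks)"
    and Dij: "\<And>i j. i < 2 * length ks \<Longrightarrow> j < 2 * length ks \<Longrightarrow> ?D $$ (i, j) =
      (if i div 2 = j div 2 then B (ks ! (i div 2)) $$ (i mod 2, j mod 2) else 0)"
    using Cons by auto
  have k: "B k \<in> carrier_mat 2 2" using Cons by simp
  have "diag_block_mat (map B (k # ks)) $$ (i, j) =
      (if i div 2 = j div 2 then B ((k # ks) ! (i div 2)) $$ (i mod 2, j mod 2) else 0)"
    if ij: "i < 2 * length (k # ks)" "j < 2 * length (k # ks)" for i j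
  proof -
    have h: "x div 2 = Suc ((x - 2) div 2) \<and> x mod 2 = (x - 2) mod 2 \<and> x - 2 < 2 * length ks"
      if "\<not> x < 2" "x < 2 * length (k # ks)" for x :: nat
      using that by (auto simp: le_div_geq le_mod_geq)
    show ?thesis
      using k D ij h[of i] h[of j] by (cases "i < 2"; cases "j < 2") (auto simp: Let_def Dij)
  qed
  moreover have "diag_block_mat (map B (k # ks)) \<in> carrier_mat (2 * length (k # ks)) (2 * length (k # ks))"
    using k D by (auto simp: Let_def)
  ultimately show ?case by blast
qed simp

definition normal_form :: "nat \<Rightarrow> (nat \<Rightarrow> real) \<Rightarrow> real mat" where
  "normal_form n l = diag_block_mat (map (\<lambda>j. mat_of_rows_list 2 [[0, l j], [- l j, 0]]) [1..<n + 1])"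

lemma index_normal_form:
  "normal_form n l \<in> carrier_mat (2 * n) (2 * n)"
  "i < 2 * n \<Longrightarrow> j < 2 * n \<Longrightarrow> normal_form n l $$ (i, j) = (if i div 2 = j div 2
     then mat_of_rows_list 2 [[0, l (Suc (i div 2))], [- l (Suc (i div 2)), 0]] $$ (i mod 2, j mod 2) else 0)"
proof -
  let ?B = "\<lambda>j. mat_of_rows_list 2 [[0, l j], [- l j, 0]]"
  have "?B k \<in> carrier_mat 2 2" for k by (auto simp: mat_of_rows_list_def intro!: carrier_matI)
  note * = diag_block_mat_2[of "[1..<n + 1]" ?B, OF this]
  show "normal_form n l \<in> carrier_mat (2 * n) (2 * n)"
    using conjunct1[OF *] unfolding normal_form_def by (simp del: upt_Suc)
  \<comment> \<open>Blocks count from 0 and normal eigenvalues from 1.\<close>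
  have nth: "[1..<n + 1] ! (i div 2) = Suc (i div 2)" if "i < 2 * n" for i
    using that by (subst nth_upt) auto
  show "i < 2 * n \<Longrightarrow> j < 2 * n \<Longrightarrow> normal_form n l $$ (i, j) = (if i div 2 = j div 2
      then ?B (Suc (i div 2)) $$ (i mod 2, j mod 2) else 0)"
    using conjunct2[OF *, rule_format, of i j] unfolding normal_form_def by (simp only: nth) simp
qed

lemmas normal_form_carrier = index_normal_form(1)

lemma normal_form_mult_vec:
  assumes x: "x \<in> carrier_vec (2 * n)" and k: "k < n"
  shows "(normal_form n l *\<^sub>v x) $ (2 * k) = l (Suc k) * x $ Suc (2 * k)"
    "(normal_form n l *\<^sub>v x) $ Suc (2 * k) = - l (Suc k) * x $ (2 * k)"
proof -
  note ij = index_normal_form(2)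
  have lt: "2 * k < 2 * n" "Suc (2 * k) < 2 * n" using k by auto
  have row: "(normal_form n l *\<^sub>v x) $ i = (\<Sum>j<n. normal_form n l $$ (i, 2 * j) * x $ (2 * j) +
      normal_form n l $$ (i, Suc (2 * j)) * x $ (Suc (2 * j)))" if "i < 2 * n" for i
    using that x carrier_matD[OF normal_form_carrier, of n l]
    by (simp add: scalar_prod_def atLeast0LessThan sum_lessThan_double)
  have "(normal_form n l *\<^sub>v x) $ (2 * k) = (\<Sum>j<n. if j = k then l (Suc k) * x $ Suc (2 * k) else 0)"
    unfolding row[OF lt(1)] by (intro sum.cong refl) (use k in \<open>auto simp: ij mat_of_rows_list_def\<close>)
  then show "(normal_form n l *\<^sub>v x) $ (2 * k) = l (Suc k) * x $ Suc (2 * k)" using k by simp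
  have "(normal_form n l *\<^sub>v x) $ Suc (2 * k) = (\<Sum>j<n. if j = k then - l (Suc k) * x $ (2 * k) else 0)"
    unfolding row[OF lt(2)] by (intro sum.cong refl) (use k in \<open>auto simp: ij mat_of_rows_list_def\<close>)
  then show "(normal_form n l *\<^sub>v x) $ Suc (2 * k) = - l (Suc k) * x $ (2 * k)" using k by simp
qed

lemma scalar_prod_self_nonneg: "v \<bullet> v \<ge> (0::real)"
  by (simp add: scalar_prod_def sum_nonneg)

lemma scalar_prod_le_sqrt:
  fixes v w :: "real vec"
  assumes "dim_vec v = dim_vec w"
  shows "v \<bullet> w \<le> sqrt (v \<bullet> v) * sqrt (w \<bullet> w)"
proof -
  have "v \<bullet> w \<le> (\<Sum>i<dim_vec w. \<bar>v $ i\<bar> * \<bar>w $ i\<bar>)"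
    unfolding scalar_prod_def atLeast0LessThan by (intro sum_mono) (metis abs_ge_self abs_mult)
  also have "\<dots> \<le> L2_set (($) v) {..<dim_vec w} * L2_set (($) w) {..<dim_vec w}"
    by (rule L2_set_mult_ineq)
  finally show ?thesis
    using assms by (simp add: L2_set_def scalar_prod_def atLeast0LessThan power2_eq_square)
qed

text \<open>On mode \<open>k\<close> the normal form is a quarter turn scaled by
  \<open>l (Suc k)\<close>. As \<open>x\<close> lives on the first \<open>t + 1\<close> modes,
  monotonicity bounds the scaling by \<open>l (t + 1)\<close>, and Cauchy-Schwarz does the
  rest.\<close>

lemma normal_form_form_le:
  assumes t: "t < n" and l: "\<forall>j\<in>{1..n}. 0 \<le> l j" "mono_on {1..n} l"
    and x: "x \<in> carrier_vec (2 * n)" and y: "y \<in> carrier_vec (2 * n)"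
    and x0: "\<And>i. 2 * t + 2 \<le> i \<Longrightarrow> i < 2 * n \<Longrightarrow> x $ i = 0"
  shows "y \<bullet> (normal_form n l *\<^sub>v x) \<le> l (t + 1) * (sqrt (y \<bullet> y) * sqrt (x \<bullet> x))"
proof -
  let ?z = "normal_form n l *\<^sub>v x"
  have z: "?z \<in> carrier_vec (2 * n)" using normal_form_carrier x by (rule mult_mat_vec_carrier)
  have lt: "0 \<le> l (t + 1)" using l(1) t by simp
  have "?z \<bullet> ?z = (\<Sum>k<n. (l (Suc k))\<^sup>2 * ((x $ (2 * k))\<^sup>2 + (x $ Suc (2 * k))\<^sup>2))"
    using z by (simp add: scalar_prod_def atLeast0LessThan sum_lessThan_double normal_form_mult_vec[OF x]
      carrier_matD[OF normal_form_carrier] del: index_mult_mat_vec) (simp add: power2_eq_square algebra_simps)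
  also have "\<dots> \<le> (\<Sum>k<n. (l (t + 1))\<^sup>2 * ((x $ (2 * k))\<^sup>2 + (x $ Suc (2 * k))\<^sup>2))"
  proof (rule sum_mono)
    fix k assume "k \<in> {..<n}"
    then have k: "k < n" by simp
    show "(l (Suc k))\<^sup>2 * ((x $ (2 * k))\<^sup>2 + (x $ Suc (2 * k))\<^sup>2)
        \<le> (l (t + 1))\<^sup>2 * ((x $ (2 * k))\<^sup>2 + (x $ Suc (2 * k))\<^sup>2)"
    proof (cases "k \<le> t")
      case True
      have "l (Suc k) \<le> l (t + 1)" using l(2) True t by (auto simp: mono_on_def)
      then show ?thesis using l(1) k by (intro mult_right_mono power_mono) auto
    next
      case False
      then show ?thesis using k x0[of "2 * k"] x0[of "Suc (2 * k)"] by simp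
    qed
  qed
  also have "\<dots> = (l (t + 1))\<^sup>2 * (x \<bullet> x)"
    using x by (simp add: scalar_prod_def atLeast0LessThan sum_lessThan_double)
      (simp add: sum_distrib_left power2_eq_square algebra_simps)
  finally have "sqrt (?z \<bullet> ?z) \<le> l (t + 1) * sqrt (x \<bullet> x)"
    using lt by (simp add: real_sqrt_le_iff real_sqrt_mult flip: real_sqrt_le_iff[of "?z \<bullet> ?z"])
  then have "sqrt (y \<bullet> y) * sqrt (?z \<bullet> ?z) \<le> sqrt (y \<bullet> y) * (l (t + 1) * sqrt (x \<bullet> x))"
    by (intro mult_left_mono) (auto simp: scalar_prod_self_nonneg)
  moreover have "y \<bullet> ?z \<le> sqrt (y \<bullet> y) * sqrt (?z \<bullet> ?z)"
    using y z by (intro scalar_prod_le_sqrt) (simp only: carrier_vecD)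
  ultimately show ?thesis by (simp add: mult_ac)
qed

text \<open>These are \<open>m - 1\<close> homogeneous equations in \<open>m\<close> unknowns. They
  fill the rows of the square matrix \<open>B\<close> except row \<open>a\<close>, which is zero;
  hence \<open>det B = 0\<close> and \<open>B\<close> has a kernel vector.\<close>

lemma ex_nonzero_vec_two_constraints:
  fixes A :: "real mat"
  assumes A: "A \<in> carrier_mat m m" and a: "a < m"
  obtains w where "w \<in> carrier_vec m" "w \<noteq> 0\<^sub>v m" "\<And>i. i < a \<Longrightarrow> w $ i = 0"
    "\<And>i. a < i \<Longrightarrow> i < m \<Longrightarrow> (A *\<^sub>v w) $ i = 0"
proof -
  define B where "B = mat m m (\<lambda>(i, j). if i < a then (if i = j then 1 else 0) else if i = a then 0 else A $$ (i, j))"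
  have B: "B \<in> carrier_mat m m" by (simp add: B_def)
  have "transpose_mat B *\<^sub>v unit_vec m a = 0\<^sub>v m"
    using a B by (intro eq_vecI) (auto simp: B_def scalar_prod_right_unit)
  moreover have "unit_vec m a \<noteq> (0\<^sub>v m :: real vec)"
    using a by (auto simp: vec_eq_iff)
  moreover have BT: "transpose_mat B \<in> carrier_mat m m" using B by simp
  ultimately have "det (transpose_mat B) = 0"
    unfolding det_0_iff_vec_prod_zero[OF BT] using unit_vec_carrier[of m a] by blast
  then have "det B = 0" using det_transpose[OF B] by simp
  then obtain w where w: "w \<in> carrier_vec m" "w \<noteq> 0\<^sub>v m" "B *\<^sub>v w = 0\<^sub>v m"
    using det_0_iff_vec_prod_zero[OF B] by blast
  have Bw: "(\<Sum>j<m. B $$ (i, j) * w $ j) = 0" if "i < m" for i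
    using arg_cong[OF w(3), of "\<lambda>v. v $ i"] that w(1) B by (simp add: scalar_prod_def atLeast0LessThan)
  show ?thesis
  proof (rule that[OF w(1,2)])
    fix i assume "i < a"
    then have "(\<Sum>j<m. B $$ (i, j) * w $ j) = (\<Sum>j<m. if j = i then w $ i else 0)"
      using a by (intro sum.cong refl) (auto simp: B_def)
    then show "w $ i = 0" using Bw[of i] a \<open>i < a\<close> by simp
  next
    fix i assume i: "a < i" "i < m"
    then have "(\<Sum>j<m. B $$ (i, j) * w $ j) = (A *\<^sub>v w) $ i"
      using A w(1) by (auto simp: B_def scalar_prod_def atLeast0LessThan intro!: sum.cong)
    then show "(A *\<^sub>v w) $ i = 0" using Bw[of i] i by simp
  qed
qed

lemma orthogonal_group_transpose: "Q \<in> orthogonal_group d \<Longrightarrow> transpose_mat Q \<in> orthogonal_group d"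
  using mat_mult_left_right_inverse[of "transpose_mat Q" d Q] by (auto simp: orthogonal_group_def)

lemma orthogonal_scalar_prod:
  assumes Q: "Q \<in> orthogonal_group d" and v: "v \<in> carrier_vec d"
  shows "(Q *\<^sub>v v) \<bullet> (Q *\<^sub>v v) = v \<bullet> v"
proof -
  have c: "Q \<in> carrier_mat d d" using Q by (simp add: orthogonal_group_def)
  show ?thesis
    using transpose_vec_mult_scalar[OF c v, of "Q *\<^sub>v v"] c v orthogonal_mult_vec[OF Q v] by simp
qed

text \<open>Stated for an arbitrary compressible state; optimality enters only through the existence
  of a minimum.\<close>

lemma overlap_bound:
  assumes t: "t < n" and \<psi>: "pure_state n \<psi>"
    and l: "normal_eigenvalues n (correlation_matrix n (density \<psi>)) l"
    and \<phi>: "\<phi> \<in> compressible_states n t"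
  shows "1 / 2 * (1 - l (t + 1)) \<le> sqrt (1 - (cmod (\<phi> \<bullet>c \<psi>))\<^sup>2)"
proof -
  let ?C = "correlation_matrix n (density \<psi>)"
  obtain G \<phi>0 where G: "gaussian_unitary n G" and \<phi>0: "pure_state t \<phi>0"
    and \<phi>_eq: "\<phi> = G *\<^sub>v kron_vec \<phi>0 (zero_state (n - t))"
    using \<phi> by (auto simp: compressible_states_def)
  define \<chi> where "\<chi> = kron_vec \<phi>0 (zero_state (n - t))"
  have \<phi>0c: "\<phi>0 \<in> carrier_vec (2 ^ t)" using \<phi>0 by (simp add: pure_state_def)
  have \<chi>: "\<chi> \<in> carrier_vec (2 ^ n)"
    using t \<phi>0c by (simp add: \<chi>_def kron_vec_zero_state_carrier)
  obtain Q where U: "unitary (2 ^ n) G" and Q: "Q \<in> orthogonal_group (2 * n)"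
    and GQ: "\<forall>\<mu>\<in>{1..2 * n}. mat_adjoint G * majorana n \<mu> * G = majorana_rotation n Q \<mu>"
    using G by (auto simp: gaussian_unitary_def)
  obtain R where R: "R \<in> orthogonal_group (2 * n)"
    and C: "?C = R * normal_form n l * transpose_mat R"
    and l': "\<forall>j\<in>{1..n}. 0 \<le> l j" "mono_on {1..n} l"
    using l by (auto simp: normal_eigenvalues_def normal_form_def)
  have Rc: "R \<in> carrier_mat (2 * n) (2 * n)" and Qc: "Q \<in> carrier_mat (2 * n) (2 * n)"
    using R Q by (auto simp: orthogonal_group_def)
  note RT = orthogonal_group_transpose[OF R]
  \<comment> \<open>The choice \<open>a = 2 * t\<close> puts \<open>w0\<close> on the modes in state
    0. In the frame of the normal form its image has coordinates only up to index
    \<open>2 * t\<close>, thus inside the first \<open>t + 1\<close> modes.\<close>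
  obtain w0 where w0: "w0 \<in> carrier_vec (2 * n)" "w0 \<noteq> 0\<^sub>v (2 * n)"
    and supp: "\<And>i. i < 2 * t \<Longrightarrow> w0 $ i = 0"
    and supp': "\<And>i. 2 * t < i \<Longrightarrow> i < 2 * n \<Longrightarrow> ((transpose_mat R * Q) *\<^sub>v w0) $ i = 0"
    using ex_nonzero_vec_two_constraints[of "transpose_mat R * Q" "2 * n" "2 * t"] Rc Qc t by auto
  \<comment> \<open>The twist comes before \<open>Q\<close>, because \<open>field_op_twist\<close>
    concerns \<open>\<chi>\<close>; \<open>field_op_gaussian\<close> then carries it to
    \<open>\<phi>\<close>.\<close>
  define w u where "w = Q *\<^sub>v w0" and "u = Q *\<^sub>v twist w0"
  have wc: "w \<in> carrier_vec (2 * n)" and uc: "u \<in> carrier_vec (2 * n)"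
    using Qc w0 by (auto simp: w_def u_def twist_carrier)
  define q where "q = w0 \<bullet> w0"
  have ww: "w \<bullet> w = q" using orthogonal_scalar_prod[OF Q w0(1)] by (simp add: w_def q_def)
  have uu: "u \<bullet> u = q"
    using orthogonal_scalar_prod[OF Q twist_carrier[OF w0(1)]] scalar_prod_twist[OF w0(1)] by (simp add: u_def q_def)
  have q0: "q > 0"
  proof -
    obtain i where "i < 2 * n" "w0 $ i \<noteq> 0" using w0 by (auto simp: vec_eq_iff)
    then show ?thesis
      using w0(1) unfolding q_def scalar_prod_def by (intro sum_pos2[where i = i]) (auto simp: zero_less_mult_iff linorder_neq_iff)
  qed
  have \<phi>n: "pure_state n \<phi>" using compressible_states_pure[OF _ \<phi>] t by simp
  have Gc: "G \<in> carrier_mat (2 ^ n) (2 ^ n)" using U by (simp add: unitary_def)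
  have w\<phi>: "field_op n w \<phi> = G *\<^sub>v field_op n w0 \<chi>"
    unfolding w_def \<phi>_eq \<chi>_def[symmetric] by (rule field_op_gaussian[OF U Q GQ \<chi> w0(1)])
  have "field_op n u \<phi> = G *\<^sub>v (- \<i> \<cdot>\<^sub>v field_op n w0 \<chi>)"
    unfolding u_def \<phi>_eq \<chi>_def[symmetric] field_op_gaussian[OF U Q GQ \<chi> twist_carrier[OF w0(1)]]
    using field_op_twist[OF _ \<phi>0c w0(1) supp] t by (simp add: \<chi>_def)
  then have u\<phi>: "field_op n u \<phi> = - \<i> \<cdot>\<^sub>v field_op n w \<phi>"
    using Gc by (simp add: w\<phi> mult_mat_vec[OF Gc])
  \<comment> \<open>The factor \<open>- \<i>\<close> sits in the conjugated argument and comes out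
    as \<open>\<i>\<close>.\<close>
  have "field_op n w \<phi> \<bullet>c field_op n u \<phi> = \<i> * (field_op n w \<phi> \<bullet>c field_op n w \<phi>)"
    unfolding u\<phi> by (simp add: cscalar_prod_sum sum_distrib_left mult_ac)
  then have "Im (field_op n w \<phi> \<bullet>c field_op n u \<phi>) = (vec_norm (field_op n w \<phi>))\<^sup>2"
    by (simp add: cscalar_prod_self del: of_real_power)
  also have "\<dots> = q"
  proof -
    have "(vec_norm \<phi>)\<^sup>2 = 1"
      using \<phi>n cscalar_prod_self[of \<phi>] of_real_eq_iff[where 'a = complex, of "(vec_norm \<phi>)\<^sup>2" 1] by (simp add: pure_state_def del: of_real_power)
    then show ?thesis
      using vec_norm_field_op[OF wc, of \<phi>] \<phi>n q0 by (simp add: pure_state_def ww power_mult_distrib)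
  qed
  finally have F\<phi>: "Im (field_op n w \<phi> \<bullet>c field_op n u \<phi>) = q" .
  have \<psi>c: "\<psi> \<in> carrier_vec (2 ^ n)" using \<psi> by (simp add: pure_state_def)
  \<comment> \<open>Coordinates of \<open>w\<close> and \<open>u\<close> in the frame of the normal
    form; lengths are preserved.\<close>
  define x y where "x = transpose_mat R *\<^sub>v w" and "y = transpose_mat R *\<^sub>v u"
  have xc: "x \<in> carrier_vec (2 * n)" and yc: "y \<in> carrier_vec (2 * n)"
    using Rc wc uc by (auto simp: x_def y_def)
  have "?C *\<^sub>v w = R *\<^sub>v (normal_form n l *\<^sub>v x)"
    unfolding C x_def using Rc normal_form_carrier[of n l] wc
    by (simp add: assoc_mult_mat_vec[where n\<^sub>1 = "2 * n" and n\<^sub>2 = "2 * n" and n\<^sub>3 = "2 * n"])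
  then have "u \<bullet> (?C *\<^sub>v w) = y \<bullet> (normal_form n l *\<^sub>v x)"
    using transpose_vec_mult_scalar[OF Rc _ uc, of "normal_form n l *\<^sub>v x"] normal_form_carrier[of n l] xc
    by (simp add: y_def)
  also have "\<dots> \<le> l (t + 1) * (sqrt (y \<bullet> y) * sqrt (x \<bullet> x))"
  proof (rule normal_form_form_le[OF t l' xc yc])
    fix i assume "2 * t + 2 \<le> i" "i < 2 * n"
    then show "x $ i = 0"
      using supp'[of i] assoc_mult_mat_vec[of "transpose_mat R" "2 * n" "2 * n" Q "2 * n" w0] Rc Qc w0
      by (simp add: x_def w_def)
  qed
  also have "\<dots> = l (t + 1) * q"
    using orthogonal_scalar_prod[OF RT wc] orthogonal_scalar_prod[OF RT uc] q0 by (simp add: x_def y_def ww uu)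
  finally have F\<psi>: "Im (field_op n w \<psi> \<bullet>c field_op n u \<psi>) \<le> l (t + 1) * q"
    by (simp add: correlation_form[OF \<psi>c uc wc])
  \<comment> \<open>Both \<open>u\<close> and \<open>w\<close> have squared length \<open>q\<close>,
    so \<open>q\<close> also bounds the right-hand side and cancels in the end.\<close>
  have "q - l (t + 1) * q \<le> 2 * sqrt (1 - (cmod (\<phi> \<bullet>c \<psi>))\<^sup>2) * q"
    using field_op_form_diff_le[OF \<phi>n \<psi> uc wc] F\<phi> F\<psi> q0 by (simp add: ww uu)
  then have "(1 - l (t + 1)) * q \<le> (2 * sqrt (1 - (cmod (\<phi> \<bullet>c \<psi>))\<^sup>2)) * q"
    by (simp add: algebra_simps)
  then show ?thesis using q0 by (simp add: mult_le_cancel_right)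
qed

theorem proposition47:
  fixes n t :: nat and \<psi> :: "complex vec" and l :: "nat \<Rightarrow> real"
  assumes "1 \<le> t" and "t < n"
    and "pure_state n \<psi>"
    and "normal_eigenvalues n (correlation_matrix n (density \<psi>)) l"
  shows "\<exists>\<phi>. is_arg_min (\<lambda>\<phi>. trace_distance (density \<psi>) (density \<phi>))
               (\<lambda>\<phi>. \<phi> \<in> compressible_states n t) \<phi> \<and>
             trace_distance (density \<psi>) (density \<phi>) \<ge> 1 / 2 * (1 - l (t + 1))"
proof -
  have td: "trace_distance (density \<psi>) (density \<phi>) = sqrt (1 - (cmod (\<phi> \<bullet>c \<psi>))\<^sup>2)"
    if "\<phi> \<in> compressible_states n t" for \<phi>
    using compressible_states_pure[OF _ that] assms by (intro trace_distance_pure_states) auto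
  \<comment> \<open>By \<open>td\<close> the distance decreases as the overlap grows, so a maximizer
    of the overlap minimizes the distance.\<close>
  obtain \<phi> where \<phi>: "\<phi> \<in> compressible_states n t"
    and max: "\<And>\<phi>'. \<phi>' \<in> compressible_states n t \<Longrightarrow> cmod (\<phi>' \<bullet>c \<psi>) \<le> cmod (\<phi> \<bullet>c \<psi>)"
    using ex_max_overlap[of t n \<psi>] assms by (auto simp: pure_state_def)
  have "is_arg_min (\<lambda>\<phi>. trace_distance (density \<psi>) (density \<phi>)) (\<lambda>\<phi>. \<phi> \<in> compressible_states n t) \<phi>"
    using \<phi> max by (auto simp: is_arg_min_linorder td power_mono)
  then show ?thesis using overlap_bound[OF assms(2-4) \<phi>] td[OF \<phi>] by auto
qed

end
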